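(* Let $u,v\in H^2(\mathbb{D})$ be such that $\{v,S^*u\}$ is linearly independent, and let $T=S+u\otimes v$ on $H^2(\mathbb{D})$. Then $T$ is quasinormal of type I if and only if there exists $\alpha\in\mathbb{D}$ such that (1) $v,\,S^*u\in\operatorname{span}\Big\{k_\alpha,\ \frac{z-\alpha}{1-\bar\alpha z}k_\alpha\Big\}$; (2) $v(\alpha)+\alpha\,(B_\alpha^*v)(\alpha)=0$; (3) $\overline{(B_\alpha^*v)(\alpha)}\,\Big\langle u,\Big(\frac{z-\alpha}{1-\bar\alpha z}\Big)^2\Big\rangle+1=0$; and (4) the matrix $$\begin{pmatrix}\overline{v(\alpha)}u(0)+\alpha\big(1+\overline{v(\alpha)}R\big) & \overline{(B_\alpha^*v)(\alpha)}\,u(0)+\alpha\,\overline{(B_\alpha^*v)(\alpha)}\,R\\ 1+\overline{v(\alpha)}R & \overline{(B_\alpha^*v)(\alpha)}\,R\end{pmatrix}$$ is normal, where $R=(1-|\alpha|^2)(S^*u)(\alpha)-\bar\alpha u(0)$.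
   Context: $H^2(\mathbb{D})$ is the Hardy space on the unit disc; $S$ is multiplication by $z$; $(u\otimes v)f=\langle f,v\rangle u$ (inner product linear in the first variable). For $\alpha\in\mathbb{D}$, $k_\alpha(z)=\frac1{1-\bar\alpha z}$ and $B_\alpha(z)=\frac{z-\alpha}{1-\bar\alpha z}$; $B_\alpha^*$ denotes the adjoint on $H^2(\mathbb{D})$ of the operator of multiplication by $B_\alpha$, so $(B_\alpha^*v)(\alpha)=\langle v,B_\alpha k_\alpha\rangle$. An operator $T$ is quasinormal if $T(T^*T)=(T^*T)T$. $T=S+u\otimes v$ is called quasinormal of type I if it is quasinormal and $\ker(I-T^*T)=\theta H^2(\mathbb{D})$ with $\theta=\big(\frac{z-\alpha}{1-\bar\alpha z}\big)^2$ for some $\alpha\in\mathbb{D}$. *)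

theory Defs
  imports "HOL-Complex_Analysis.Complex_Analysis"
begin

section \<open>The Hardy space of the unit disc\<close>

definition taylor_coeff :: "(complex \<Rightarrow> complex) \<Rightarrow> nat \<Rightarrow> complex" where
  "taylor_coeff f n = (deriv ^^ n) f 0 / fact n"

definition in_hardy :: "(complex \<Rightarrow> complex) \<Rightarrow> bool" where
  "in_hardy f \<longleftrightarrow> f holomorphic_on ball 0 1 \<and> summable (\<lambda>n. (cmod (taylor_coeff f n))\<^sup>2)"

lemma taylor_coeff_cong:
  assumes "\<And>z. z \<in> ball 0 1 \<Longrightarrow> f z = g z"
  shows "taylor_coeff f = taylor_coeff g"
proof
  fix n
  have "eventually (\<lambda>z. z \<in> ball 0 1) (nhds (0::complex))"
    by (intro eventually_nhds_in_open) auto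
  then have "eventually (\<lambda>z. f z = g z) (nhds 0)"
    by eventually_elim (use assms in auto)
  then show "taylor_coeff f n = taylor_coeff g n"
    unfolding taylor_coeff_def by (simp add: higher_deriv_cong_ev)
qed

lemma in_hardy_cong:
  assumes "\<And>z. z \<in> ball 0 1 \<Longrightarrow> f z = g z"
  shows "in_hardy f \<longleftrightarrow> in_hardy g"
proof -
  have "taylor_coeff f = taylor_coeff g"
    by (rule taylor_coeff_cong) (rule assms)
  moreover have "f holomorphic_on ball 0 1 \<longleftrightarrow> g holomorphic_on ball 0 1"
    by (rule holomorphic_cong[OF refl]) (rule assms)
  ultimately show ?thesis by (simp add: in_hardy_def)
qed

lemma taylor_coeff_sums:
  assumes "in_hardy f" "z \<in> ball 0 1"
  shows "(\<lambda>n. taylor_coeff f n * z ^ n) sums f z"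
  using holomorphic_power_series[of f 0 1 z] assms
  by (simp add: in_hardy_def taylor_coeff_def)

lemma power_series_disc:
  assumes "\<And>z. z \<in> ball 0 1 \<Longrightarrow> (\<lambda>n. a n * z ^ n) sums f z"
  shows "f holomorphic_on ball 0 1" and "taylor_coeff f = a"
proof -
  show "f holomorphic_on ball 0 1"
    by (rule power_series_holomorphic[where a = a]) (use assms in simp)
  have "eventually (\<lambda>z. z \<in> ball 0 1) (nhds (0::complex))"
    by (intro eventually_nhds_in_open) auto
  then have "eventually (\<lambda>z. (\<lambda>n. fps_nth (Abs_fps a) n * z ^ n) sums f z) (nhds 0)"
    by eventually_elim (use assms in simp)
  then have "f has_fps_expansion Abs_fps a"
    by (rule has_fps_expansionI)
  from fps_nth_fps_expansion[OF this] show "taylor_coeff f = a"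
    by (auto simp: taylor_coeff_def)
qed

lemma in_hardyI:
  assumes "\<And>z. z \<in> ball 0 1 \<Longrightarrow> (\<lambda>n. a n * z ^ n) sums f z"
    and "summable (\<lambda>n. (cmod (a n))\<^sup>2)"
  shows "in_hardy f"
  using power_series_disc[OF assms(1)] assms(2) by (simp add: in_hardy_def)

lemma square_summable_power_series:
  fixes a :: "nat \<Rightarrow> complex"
  assumes "summable (\<lambda>n. (cmod (a n))\<^sup>2)" "z \<in> ball 0 1"
  shows "summable (\<lambda>n. a n * z ^ n)"
proof (rule summable_comparison_test')
  have z: "(cmod z)\<^sup>2 < 1" using assms(2) by (simp add: power_less_one_iff)
  show "summable (\<lambda>n. (cmod (a n))\<^sup>2 + ((cmod z)\<^sup>2) ^ n)"
    by (intro summable_add assms summable_geometric) (use z in simp)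
  fix n :: nat
  have "0 \<le> (cmod (a n) - cmod z ^ n)\<^sup>2" by simp
  then have "2 * (cmod (a n) * cmod z ^ n) \<le> (cmod (a n))\<^sup>2 + (cmod z ^ n)\<^sup>2"
    by (simp add: power2_diff)
  moreover have "0 \<le> cmod (a n) * cmod z ^ n" by simp
  moreover have "(cmod z ^ n)\<^sup>2 = ((cmod z)\<^sup>2) ^ n"
    by (simp flip: power_mult add: mult.commute)
  ultimately show "norm (a n * z ^ n) \<le> (cmod (a n))\<^sup>2 + ((cmod z)\<^sup>2) ^ n"
    unfolding norm_mult norm_power by linarith
qed

lemma square_summable_add:
  fixes a b :: "nat \<Rightarrow> complex"
  assumes "summable (\<lambda>n. (cmod (a n))\<^sup>2)" "summable (\<lambda>n. (cmod (b n))\<^sup>2)"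
  shows "summable (\<lambda>n. (cmod (a n + b n))\<^sup>2)"
proof (rule summable_comparison_test')
  show "summable (\<lambda>n. 2 * ((cmod (a n))\<^sup>2 + (cmod (b n))\<^sup>2))"
    by (intro summable_mult summable_add assms)
  fix n :: nat
  have "(cmod (a n + b n))\<^sup>2 \<le> (cmod (a n) + cmod (b n))\<^sup>2"
    by (intro power_mono norm_triangle_ineq) auto
  also have "\<dots> \<le> 2 * ((cmod (a n))\<^sup>2 + (cmod (b n))\<^sup>2)"
    using sum_squares_bound[of "cmod (a n)" "cmod (b n)"] by (simp add: power2_sum)
  finally show "norm ((cmod (a n + b n))\<^sup>2) \<le> 2 * ((cmod (a n))\<^sup>2 + (cmod (b n))\<^sup>2)"
    by simp
qed

lemma in_hardy_add:
  assumes "in_hardy f" "in_hardy g"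
  shows "in_hardy (\<lambda>z. f z + g z)"
    and "taylor_coeff (\<lambda>z. f z + g z) = (\<lambda>n. taylor_coeff f n + taylor_coeff g n)"
proof -
  have *: "(\<lambda>n. (taylor_coeff f n + taylor_coeff g n) * z ^ n) sums (f z + g z)"
    if "z \<in> ball 0 1" for z
    using sums_add[OF taylor_coeff_sums[OF assms(1) that] taylor_coeff_sums[OF assms(2) that]]
    by (simp add: ring_distribs)
  show "taylor_coeff (\<lambda>z. f z + g z) = (\<lambda>n. taylor_coeff f n + taylor_coeff g n)"
    by (rule power_series_disc(2)) (use * in simp)
  show "in_hardy (\<lambda>z. f z + g z)"
    by (rule in_hardyI[OF *]) (use assms in \<open>auto simp: in_hardy_def intro: square_summable_add\<close>)
qed

lemma in_hardy_cmult:
  assumes "in_hardy f"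
  shows "in_hardy (\<lambda>z. c * f z)"
    and "taylor_coeff (\<lambda>z. c * f z) = (\<lambda>n. c * taylor_coeff f n)"
proof -
  have *: "(\<lambda>n. (c * taylor_coeff f n) * z ^ n) sums (c * f z)" if "z \<in> ball 0 1" for z
    using sums_mult[OF taylor_coeff_sums[OF assms(1) that], of c] by (simp add: mult.assoc)
  show "taylor_coeff (\<lambda>z. c * f z) = (\<lambda>n. c * taylor_coeff f n)"
    by (rule power_series_disc(2)) (use * in simp)
  show "in_hardy (\<lambda>z. c * f z)"
    by (rule in_hardyI[OF *])
      (use assms in \<open>auto simp: in_hardy_def norm_mult power_mult_distrib intro: summable_mult\<close>)
qed

lemma in_hardy_const: "in_hardy (\<lambda>z. c)"
proof (rule in_hardyI)
  show "(\<lambda>n. (if n = 0 then c else 0) * z ^ n) sums c" for z :: complex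
    using sums_finite[of "{0}" "\<lambda>n. (if n = 0 then c else 0) * z ^ n"] by simp
  show "summable (\<lambda>n. (cmod (if n = 0 then c else 0))\<^sup>2)"
    by (rule summable_finite[of "{0}"]) auto
qed

lemma in_hardy_mult_z:
  assumes "in_hardy f"
  shows "in_hardy (\<lambda>z. z * f z)"
proof (rule in_hardyI)
  let ?a = "\<lambda>n. case n of 0 \<Rightarrow> 0 | Suc m \<Rightarrow> taylor_coeff f m"
  show "(\<lambda>n. ?a n * z ^ n) sums (z * f z)" if "z \<in> ball 0 1" for z
  proof -
    have "(\<lambda>n. ?a (Suc n) * z ^ Suc n) sums (z * f z)"
      using sums_mult[OF taylor_coeff_sums[OF assms that], of z] by (simp add: mult_ac)
    then show ?thesis by (subst (asm) sums_Suc_iff) simp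
  qed
  have "summable (\<lambda>n. (cmod (?a (Suc n)))\<^sup>2)"
    using assms by (simp add: in_hardy_def)
  then show "summable (\<lambda>n. (cmod (?a n))\<^sup>2)"
    by (subst (asm) summable_Suc_iff)
qed

text \<open>The Taylor coefficients of \<open>f z / (1 - q z)\<close> when \<open>f\<close> has Taylor coefficients \<open>a\<close>.\<close>

primrec geom_conv :: "complex \<Rightarrow> (nat \<Rightarrow> complex) \<Rightarrow> nat \<Rightarrow> complex" where
  "geom_conv q a 0 = a 0"
| "geom_conv q a (Suc n) = q * geom_conv q a n + a (Suc n)"

lemma in_hardy_divide:
  assumes f: "in_hardy f" and \<alpha>: "cmod \<alpha> < 1"
  shows "in_hardy (\<lambda>z. f z / (1 - cnj \<alpha> * z))"
proof (rule in_hardyI)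
  define a where "a = taylor_coeff f"
  define c where "c = geom_conv (cnj \<alpha>) a"
  have c0: "c 0 = a 0" and cS: "c (Suc n) = cnj \<alpha> * c n + a (Suc n)" for n
    by (simp_all add: c_def)
  have a: "summable (\<lambda>n. (cmod (a n))\<^sup>2)"
    using f by (simp add: in_hardy_def a_def)
  define A where "A = sqrt (\<Sum>n. (cmod (a n))\<^sup>2)"
  have La: "L2_set (\<lambda>n. cmod (a n)) {..<N} \<le> A" for N
    unfolding L2_set_def A_def using a by (intro real_sqrt_le_mono sum_le_suminf) auto
  have bound: "L2_set (\<lambda>n. cmod (c n)) {..<N} \<le> A / (1 - cmod \<alpha>)" for N
  proof -
    define b where "b n = (case n of 0 \<Rightarrow> 0 | Suc m \<Rightarrow> cmod (c m))" for n
    have shift: "L2_set b {..<N} \<le> L2_set (\<lambda>n. cmod (c n)) {..<N}"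
    proof (cases N)
      case (Suc M)
      have "(\<Sum>n<N. (b n)\<^sup>2) = (\<Sum>n<M. (cmod (c n))\<^sup>2)"
        unfolding Suc sum.lessThan_Suc_shift by (simp add: b_def)
      also have "\<dots> \<le> (\<Sum>n<N. (cmod (c n))\<^sup>2)"
        by (simp add: Suc)
      finally show ?thesis unfolding L2_set_def by simp
    qed simp
    have "L2_set (\<lambda>n. cmod (c n)) {..<N} \<le> L2_set (\<lambda>n. cmod \<alpha> * b n + cmod (a n)) {..<N}"
    proof (rule L2_set_mono)
      fix n
      show "cmod (c n) \<le> cmod \<alpha> * b n + cmod (a n)"
      proof (cases n)
        case (Suc m)
        then show ?thesis
          using norm_triangle_ineq[of "cnj \<alpha> * c m" "a (Suc m)"]
          by (simp add: cS b_def norm_mult)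
      qed (simp add: c0 b_def)
    qed simp
    also have "\<dots> \<le> L2_set (\<lambda>n. cmod \<alpha> * b n) {..<N} + L2_set (\<lambda>n. cmod (a n)) {..<N}"
      by (rule L2_set_triangle_ineq)
    also have "L2_set (\<lambda>n. cmod \<alpha> * b n) {..<N} = cmod \<alpha> * L2_set b {..<N}"
      by (simp add: L2_set_right_distrib)
    also have "\<dots> \<le> cmod \<alpha> * L2_set (\<lambda>n. cmod (c n)) {..<N}"
      by (intro mult_left_mono shift) simp
    finally have "L2_set (\<lambda>n. cmod (c n)) {..<N} * (1 - cmod \<alpha>) \<le> A"
      using La[of N] by (simp add: algebra_simps)
    then show ?thesis using \<alpha> by (simp add: pos_le_divide_eq)
  qed
  show c: "summable (\<lambda>n. (cmod (c n))\<^sup>2)"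
  proof (rule summableI_nonneg_bounded)
    fix N
    have "(\<Sum>n<N. (cmod (c n))\<^sup>2) = (L2_set (\<lambda>n. cmod (c n)) {..<N})\<^sup>2"
      by (simp add: L2_set_def sum_nonneg)
    also have "\<dots> \<le> (A / (1 - cmod \<alpha>))\<^sup>2"
      by (intro power_mono bound) simp
    finally show "(\<Sum>n<N. (cmod (c n))\<^sup>2) \<le> (A / (1 - cmod \<alpha>))\<^sup>2" .
  qed simp
  show "(\<lambda>n. c n * z ^ n) sums (f z / (1 - cnj \<alpha> * z))" if z: "z \<in> ball 0 1" for z
  proof -
    obtain G where G: "(\<lambda>n. c n * z ^ n) sums G"
      using square_summable_power_series[OF c z] by (auto simp: summable_def)
    have 1: "(\<lambda>n. cnj \<alpha> * z * (c n * z ^ n)) sums (cnj \<alpha> * z * G)"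
      by (intro sums_mult G)
    have 2: "(\<lambda>n. a (Suc n) * z ^ Suc n) sums (f z - a 0)"
      using taylor_coeff_sums[OF f z, folded a_def] by (subst sums_Suc_iff) simp
    have "(\<lambda>n. c (Suc n) * z ^ Suc n) sums (cnj \<alpha> * z * G + (f z - a 0))"
      using sums_add[OF 1 2] by (simp add: cS ring_distribs mult_ac)
    then have "(\<lambda>n. c n * z ^ n) sums (cnj \<alpha> * z * G + f z)"
      by (subst (asm) sums_Suc_iff) (simp add: c0)
    then have "G = cnj \<alpha> * z * G + f z"
      using G sums_unique2 by blast
    moreover have "cnj \<alpha> * z \<noteq> 1"
    proof
      assume "cnj \<alpha> * z = 1"
      then have "cmod \<alpha> * cmod z = 1" by (metis complex_mod_cnj norm_mult norm_one)
      moreover have "cmod \<alpha> * cmod z < 1"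
        using \<alpha> z mult_strict_mono'[of "cmod \<alpha>" 1 "cmod z" 1] by simp
      ultimately show False by simp
    qed
    ultimately have "G = f z / (1 - cnj \<alpha> * z)"
      by (simp add: eq_divide_eq right_diff_distrib mult_ac) (simp add: diff_eq_eq add.commute)
    with G show ?thesis by simp
  qed
qed

text \<open>Elements are functions on the open unit disc, represented as total functions that vanish
  outside the disc.\<close>

typedef hardy = "{f. in_hardy f \<and> (\<forall>z. z \<notin> ball 0 1 \<longrightarrow> f z = 0)}"
  morphisms hardy_eval Abs_hardy
  using in_hardy_const[of 0] by blast

definition to_hardy :: "(complex \<Rightarrow> complex) \<Rightarrow> hardy" where
  "to_hardy f = Abs_hardy (\<lambda>z. if z \<in> ball 0 1 then f z else 0)"

lemma hardy_eval_to_hardy: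
  assumes "in_hardy f"
  shows "hardy_eval (to_hardy f) = (\<lambda>z. if z \<in> ball 0 1 then f z else 0)"
proof -
  have "in_hardy (\<lambda>z. if z \<in> ball 0 1 then f z else 0) \<longleftrightarrow> in_hardy f"
    by (rule in_hardy_cong) simp
  with assms show ?thesis
    unfolding to_hardy_def by (intro Abs_hardy_inverse) simp
qed

lemma in_hardy_eval: "in_hardy (hardy_eval f)"
  using hardy_eval[of f] by simp

lemma hardy_eqI:
  assumes "\<And>z. z \<in> ball 0 1 \<Longrightarrow> hardy_eval f z = hardy_eval g z"
  shows "f = g"
proof -
  have "hardy_eval f = hardy_eval g"
  proof
    fix z show "hardy_eval f z = hardy_eval g z"
      using assms[of z] hardy_eval[of f] hardy_eval[of g] by (cases "z \<in> ball 0 1") auto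
  qed
  then show ?thesis by (simp add: hardy_eval_inject)
qed

definition hardy_coeff :: "hardy \<Rightarrow> nat \<Rightarrow> complex" where
  "hardy_coeff f = taylor_coeff (hardy_eval f)"

lemma hardy_coeff_to_hardy:
  assumes "in_hardy f"
  shows "hardy_coeff (to_hardy f) = taylor_coeff f"
  unfolding hardy_coeff_def hardy_eval_to_hardy[OF assms] by (rule taylor_coeff_cong) simp

lemma hardy_eval_sums:
  assumes "z \<in> ball 0 1"
  shows "(\<lambda>n. hardy_coeff f n * z ^ n) sums hardy_eval f z"
  unfolding hardy_coeff_def by (rule taylor_coeff_sums[OF in_hardy_eval assms])

lemma hardy_coeff_eqI:
  assumes "\<And>n. hardy_coeff f n = hardy_coeff g n"
  shows "f = g"
proof (rule hardy_eqI)
  fix z :: complex assume z: "z \<in> ball 0 1"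
  have "hardy_coeff f = hardy_coeff g" using assms by (rule ext)
  then show "hardy_eval f z = hardy_eval g z"
    using hardy_eval_sums[OF z, of f] hardy_eval_sums[OF z, of g] by (simp add: sums_unique2)
qed

lemma square_summable_hardy_coeff: "summable (\<lambda>n. (cmod (hardy_coeff f n))\<^sup>2)"
  using in_hardy_eval[of f] by (simp add: in_hardy_def hardy_coeff_def)

definition scaleC :: "complex \<Rightarrow> hardy \<Rightarrow> hardy" (infixr \<open>*\<^sub>C\<close> 75) where
  "c *\<^sub>C f = to_hardy (\<lambda>z. c * hardy_eval f z)"

text \<open>The inner product is linear in the first variable.\<close>

definition cinner :: "hardy \<Rightarrow> hardy \<Rightarrow> complex" where
  "cinner f g = (\<Sum>n. hardy_coeff f n * cnj (hardy_coeff g n))"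

lemma summable_cinner: "summable (\<lambda>n. hardy_coeff f n * cnj (hardy_coeff g n))"
proof (rule summable_comparison_test')
  show "summable (\<lambda>n. (cmod (hardy_coeff f n))\<^sup>2 + (cmod (hardy_coeff g n))\<^sup>2)"
    by (intro summable_add square_summable_hardy_coeff)
  fix n :: nat
  have "0 \<le> cmod (hardy_coeff f n) * cmod (hardy_coeff g n)" by simp
  then show "norm (hardy_coeff f n * cnj (hardy_coeff g n))
      \<le> (cmod (hardy_coeff f n))\<^sup>2 + (cmod (hardy_coeff g n))\<^sup>2"
    using sum_squares_bound[of "cmod (hardy_coeff f n)" "cmod (hardy_coeff g n)"]
    unfolding norm_mult complex_mod_cnj by linarith
qed

instantiation hardy :: real_inner
begin

definition zero_hardy :: hardy where "0 = to_hardy (\<lambda>z. 0)"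
definition plus_hardy :: "hardy \<Rightarrow> hardy \<Rightarrow> hardy" where
  "f + g = to_hardy (\<lambda>z. hardy_eval f z + hardy_eval g z)"
definition uminus_hardy :: "hardy \<Rightarrow> hardy" where
  "- f = (-1) *\<^sub>C f"
definition minus_hardy :: "hardy \<Rightarrow> hardy \<Rightarrow> hardy" where
  "f - g = f + - (g :: hardy)"
definition scaleR_hardy :: "real \<Rightarrow> hardy \<Rightarrow> hardy" where
  "r *\<^sub>R f = complex_of_real r *\<^sub>C f"
definition inner_hardy :: "hardy \<Rightarrow> hardy \<Rightarrow> real" where
  "inner f g = Re (cinner f g)"
definition norm_hardy :: "hardy \<Rightarrow> real" where
  "norm f = sqrt (inner f (f :: hardy))"
definition sgn_hardy :: "hardy \<Rightarrow> hardy" where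
  "sgn f = inverse (norm f) *\<^sub>R (f :: hardy)"
definition dist_hardy :: "hardy \<Rightarrow> hardy \<Rightarrow> real" where
  "dist f g = norm (f - (g :: hardy))"
definition uniformity_hardy :: "(hardy \<times> hardy) filter" where
  "uniformity = (INF e\<in>{0<..}. principal {(x, y :: hardy). dist x y < e})"
definition open_hardy :: "hardy set \<Rightarrow> bool" where
  "open U = (\<forall>x\<in>U. \<forall>\<^sub>F (x' :: hardy, y) in uniformity. x' = x \<longrightarrow> y \<in> U)"

lemma hardy_eval_scaleC [simp]: "hardy_eval (c *\<^sub>C f) z = c * hardy_eval f z"
  using hardy_eval_to_hardy[OF in_hardy_cmult(1)[OF in_hardy_eval[of f], of c]] hardy_eval[of f]
  by (auto simp: scaleC_def)

lemma hardy_eval_plus [simp]: "hardy_eval (f + g) z = hardy_eval f z + hardy_eval g z"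
  using hardy_eval_to_hardy[OF in_hardy_add(1)[OF in_hardy_eval[of f] in_hardy_eval[of g]]]
    hardy_eval[of f] hardy_eval[of g]
  by (auto simp: plus_hardy_def)

lemma hardy_eval_zero [simp]: "hardy_eval 0 z = 0"
  using hardy_eval_to_hardy[OF in_hardy_const[of 0]] by (simp add: zero_hardy_def)

lemma hardy_coeff_zero [simp]: "hardy_coeff 0 n = 0"
  using hardy_coeff_to_hardy[OF in_hardy_const[of 0]]
  by (simp add: zero_hardy_def taylor_coeff_def)

lemma hardy_coeff_scaleC [simp]: "hardy_coeff (c *\<^sub>C f) n = c * hardy_coeff f n"
  unfolding scaleC_def hardy_coeff_to_hardy[OF in_hardy_cmult(1)[OF in_hardy_eval]]
    in_hardy_cmult(2)[OF in_hardy_eval]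
  by (simp add: hardy_coeff_def)

lemma hardy_coeff_plus [simp]: "hardy_coeff (f + g) n = hardy_coeff f n + hardy_coeff g n"
  unfolding plus_hardy_def hardy_coeff_to_hardy[OF in_hardy_add(1)[OF in_hardy_eval in_hardy_eval]]
    in_hardy_add(2)[OF in_hardy_eval in_hardy_eval]
  by (simp add: hardy_coeff_def)

lemma inner_hardy_self:
  "inner f f = (\<Sum>n. (cmod (hardy_coeff f n))\<^sup>2)" for f :: hardy
proof -
  have "cinner f f = complex_of_real (\<Sum>n. (cmod (hardy_coeff f n))\<^sup>2)"
    unfolding cinner_def complex_norm_square[symmetric]
    by (rule suminf_of_real[OF square_summable_hardy_coeff, symmetric])
  then show ?thesis by (simp add: inner_hardy_def)
qed

instance
proof
  fix f g h :: hardy and r s :: real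
  show "f + g + h = f + (g + h)" by (rule hardy_eqI) simp
  show "f + g = g + f" by (rule hardy_eqI) simp
  show "0 + f = f" by (rule hardy_eqI) simp
  show "- f + f = 0" by (rule hardy_eqI) (simp add: uminus_hardy_def)
  show "f - g = f + - g" by (fact minus_hardy_def)
  show "r *\<^sub>R (f + g) = r *\<^sub>R f + r *\<^sub>R g"
    by (rule hardy_eqI) (simp add: scaleR_hardy_def ring_distribs)
  show "(r + s) *\<^sub>R f = r *\<^sub>R f + s *\<^sub>R f"
    by (rule hardy_eqI) (simp add: scaleR_hardy_def ring_distribs)
  show "r *\<^sub>R s *\<^sub>R f = (r * s) *\<^sub>R f"
    by (rule hardy_eqI) (simp add: scaleR_hardy_def)
  show "1 *\<^sub>R f = f" by (rule hardy_eqI) (simp add: scaleR_hardy_def)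
  show "sgn f = inverse (norm f) *\<^sub>R f" by (fact sgn_hardy_def)
  show "dist f g = norm (f - g)" by (fact dist_hardy_def)
  show "(uniformity :: (hardy \<times> hardy) filter) = (INF e\<in>{0<..}. principal {(x, y). dist x y < e})"
    by (fact uniformity_hardy_def)
  show "open U = (\<forall>x\<in>U. \<forall>\<^sub>F (x', y) in uniformity. x' = x \<longrightarrow> y \<in> U)" for U :: "hardy set"
    by (fact open_hardy_def)
  have "cinner g f = cnj (cinner f g)"
  proof -
    have "(\<lambda>n. cnj (hardy_coeff f n * cnj (hardy_coeff g n))) sums cnj (cinner f g)"
      unfolding cinner_def by (intro sums_cnj[THEN iffD2] summable_sums summable_cinner)
    from sums_unique[OF this] show ?thesis
      unfolding cinner_def[of g f] by (simp add: mult.commute)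
  qed
  then show "inner f g = inner g f" by (simp add: inner_hardy_def)
  have "cinner (f + g) h = cinner f h + cinner g h"
    unfolding cinner_def hardy_coeff_plus ring_distribs
    by (rule suminf_add[OF summable_cinner summable_cinner, symmetric])
  then show "inner (f + g) h = inner f h + inner g h"
    by (simp add: inner_hardy_def)
  have "cinner (r *\<^sub>R f) g = complex_of_real r * cinner f g"
    unfolding cinner_def scaleR_hardy_def hardy_coeff_scaleC mult.assoc
    by (rule suminf_mult[OF summable_cinner])
  then show "inner (r *\<^sub>R f) g = r * inner f g"
    by (simp add: inner_hardy_def)
  show "0 \<le> inner f f"
    unfolding inner_hardy_self by (intro suminf_nonneg square_summable_hardy_coeff) simp
  show "inner f f = 0 \<longleftrightarrow> f = 0"
  proof
    assume "inner f f = 0"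
    then have "hardy_coeff f n = hardy_coeff 0 n" for n
      unfolding inner_hardy_self
      using suminf_eq_zero_iff[OF square_summable_hardy_coeff[of f]] by simp
    then show "f = 0" by (rule hardy_coeff_eqI)
  next
    assume "f = 0"
    then show "inner f f = 0" by (simp add: inner_hardy_self)
  qed
  show "norm f = sqrt (inner f f)" by (fact norm_hardy_def)
qed

end

text \<open>The type-class operations \<open>span\<close> and \<open>independent\<close> on \<open>hardy\<close> refer to real scalars; the
  complex ones are \<open>hardy.span\<close> and \<open>hardy.independent\<close>.\<close>

interpretation hardy: vector_space scaleC
  by unfold_locales (auto intro!: hardy_eqI simp: ring_distribs)


section \<open>Operators\<close>

definition bounded_operator :: "(hardy \<Rightarrow> hardy) \<Rightarrow> bool" where
  "bounded_operator T \<longleftrightarrow> bounded_linear T \<and> (\<forall>c f. T (c *\<^sub>C f) = c *\<^sub>C T f)"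

text \<open>Unspecified when \<open>T\<close> has no adjoint; every bounded operator has one.\<close>

definition adj :: "(hardy \<Rightarrow> hardy) \<Rightarrow> hardy \<Rightarrow> hardy" where
  "adj T = (THE A. \<forall>f g. cinner (T f) g = cinner f (A g))"

text \<open>Unspecified when \<open>\<phi> f\<close> is not in the Hardy space for some \<open>f\<close>; it is used only for \<open>z\<close> and
  for powers of Blaschke factors.\<close>

definition mult_op :: "(complex \<Rightarrow> complex) \<Rightarrow> hardy \<Rightarrow> hardy" where
  "mult_op \<phi> f = to_hardy (\<lambda>z. \<phi> z * hardy_eval f z)"

definition shift :: "hardy \<Rightarrow> hardy" where
  "shift = mult_op (\<lambda>z. z)"

definition rank_one :: "hardy \<Rightarrow> hardy \<Rightarrow> hardy \<Rightarrow> hardy" where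
  "rank_one u v f = cinner f v *\<^sub>C u"

definition szego :: "complex \<Rightarrow> hardy" where
  "szego \<alpha> = to_hardy (\<lambda>z. 1 / (1 - cnj \<alpha> * z))"

definition blaschke :: "complex \<Rightarrow> complex \<Rightarrow> complex" where
  "blaschke \<alpha> z = (z - \<alpha>) / (1 - cnj \<alpha> * z)"

definition quasinormal :: "(hardy \<Rightarrow> hardy) \<Rightarrow> bool" where
  "quasinormal T \<longleftrightarrow> bounded_operator T \<and> T \<circ> (adj T \<circ> T) = (adj T \<circ> T) \<circ> T"

definition quasinormal_type_I :: "(hardy \<Rightarrow> hardy) \<Rightarrow> bool" where
  "quasinormal_type_I T \<longleftrightarrow> quasinormal T \<and>
     (\<exists>\<alpha>\<in>ball 0 1. {f. f - adj T (T f) = 0} = range (mult_op (\<lambda>z. (blaschke \<alpha> z)\<^sup>2)))"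

definition normal_matrix :: "complex^'n^'n \<Rightarrow> bool" where
  "normal_matrix A \<longleftrightarrow>
     A ** map_matrix cnj (transpose A) = map_matrix cnj (transpose A) ** A"

lemma in_hardy_mult_blaschke:
  assumes f: "in_hardy f" and \<alpha>: "\<alpha> \<in> ball 0 1"
  shows "in_hardy (\<lambda>z. blaschke \<alpha> z * f z)"
proof -
  have "in_hardy (\<lambda>z. (z * f z + (- \<alpha>) * f z) / (1 - cnj \<alpha> * z))"
    by (intro in_hardy_divide in_hardy_add(1) in_hardy_mult_z in_hardy_cmult(1) f) (use \<alpha> in simp)
  then show ?thesis by (simp add: blaschke_def ring_distribs)
qed

lemma hardy_eval_shift:
  "z \<in> ball 0 1 \<Longrightarrow> hardy_eval (shift f) z = z * hardy_eval f z"
  unfolding shift_def mult_op_def hardy_eval_to_hardy[OF in_hardy_mult_z[OF in_hardy_eval]] by simp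

lemma hardy_eval_mult_op_blaschke:
  "\<alpha> \<in> ball 0 1 \<Longrightarrow> z \<in> ball 0 1 \<Longrightarrow>
     hardy_eval (mult_op (blaschke \<alpha>) f) z = blaschke \<alpha> z * hardy_eval f z"
  unfolding mult_op_def
  by (simp add: hardy_eval_to_hardy[OF in_hardy_mult_blaschke[OF in_hardy_eval]])

lemma hardy_eval_mult_op_blaschke_squared:
  assumes "\<alpha> \<in> ball 0 1" "z \<in> ball 0 1"
  shows "hardy_eval (mult_op (\<lambda>z. (blaschke \<alpha> z)\<^sup>2) f) z = (blaschke \<alpha> z)\<^sup>2 * hardy_eval f z"
proof -
  have "in_hardy (\<lambda>z. (blaschke \<alpha> z)\<^sup>2 * hardy_eval f z)"
    using in_hardy_mult_blaschke[OF in_hardy_mult_blaschke[OF in_hardy_eval assms(1)] assms(1), of f]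
    by (simp add: power2_eq_square mult.assoc)
  from hardy_eval_to_hardy[OF this] assms(2) show ?thesis by (simp add: mult_op_def)
qed

lemma hardy_eval_szego:
  assumes "\<alpha> \<in> ball 0 1" "z \<in> ball 0 1"
  shows "hardy_eval (szego \<alpha>) z = 1 / (1 - cnj \<alpha> * z)"
  using hardy_eval_to_hardy[OF in_hardy_divide[OF in_hardy_const[of 1], of \<alpha>]] assms
  by (simp add: szego_def)

lemma hardy_eval_blaschke_squared:
  assumes "\<alpha> \<in> ball 0 1" "z \<in> ball 0 1"
  shows "hardy_eval (to_hardy (\<lambda>z. (blaschke \<alpha> z)\<^sup>2)) z = (blaschke \<alpha> z)\<^sup>2"
proof -
  have "in_hardy (\<lambda>z. (blaschke \<alpha> z)\<^sup>2)"
    using in_hardy_mult_blaschke[OF in_hardy_mult_blaschke[OF in_hardy_const[of 1] assms(1)] assms(1)]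
    by (simp add: power2_eq_square)
  from hardy_eval_to_hardy[OF this] assms(2) show ?thesis by simp
qed

end

theory Submission
  imports Defs
begin

text \<open>
  The defect \<open>D = I - T\<^sup>* T\<close> has range \<open>span {v, S\<^sup>* u}\<close>, so its kernel is \<open>B\<^sub>\<alpha>\<^sup>2 H\<^sup>2\<close> exactly
  when \<open>v\<close> and \<open>S\<^sup>* u\<close> span the model space \<open>M = span {k\<^sub>\<alpha>, B\<^sub>\<alpha> k\<^sub>\<alpha>}\<close>; this is condition (1).
  Quasinormality says that \<open>T\<close> commutes with \<open>D\<close>.  Since \<open>T\<close> acts as the shift on the complement of \<open>M\<close>
  and \<open>D\<close> vanishes there, this means that \<open>T M \<subseteq> M\<close> and that the restriction of \<open>T\<close> to \<open>M\<close> is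
  quasinormal, hence normal because \<open>M\<close> has finite dimension.  Given (1), \<open>T M\<close> is orthogonal to
  \<open>z B\<^sub>\<alpha>\<^sup>2 H\<^sup>2\<close>, so invariance of \<open>M\<close> only requires \<open>T k\<^sub>\<alpha>\<close> and \<open>T (B\<^sub>\<alpha> k\<^sub>\<alpha>)\<close> to be orthogonal to
  \<open>B\<^sub>\<alpha>\<^sup>2\<close>, which is (2) and (3).  The matrix in (4) is that of the restriction in the basis
  \<open>k\<^sub>\<alpha>, B\<^sub>\<alpha> k\<^sub>\<alpha>\<close>, whose vectors are orthogonal and of equal norm.
\<close>

section \<open>The complex inner product\<close>

lemma hardy_eval_uminus [simp]: "hardy_eval (- f) z = - hardy_eval f z"
  unfolding uminus_hardy_def hardy_eval_scaleC by simp

lemma hardy_eval_diff [simp]: "hardy_eval (f - g) z = hardy_eval f z - hardy_eval g z"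
  unfolding minus_hardy_def hardy_eval_plus by simp

lemma hardy_coeff_uminus [simp]: "hardy_coeff (- f) n = - hardy_coeff f n"
  unfolding uminus_hardy_def hardy_coeff_scaleC by simp

lemma hardy_coeff_diff [simp]: "hardy_coeff (f - g) n = hardy_coeff f n - hardy_coeff g n"
  unfolding minus_hardy_def hardy_coeff_plus by simp

lemma hardy_coeff_sum [simp]: "hardy_coeff (sum f A) n = (\<Sum>i\<in>A. hardy_coeff (f i) n)"
  by (induction A rule: infinite_finite_induct) simp_all

lemma hardy_coeff_0: "hardy_coeff f 0 = hardy_eval f 0"
  by (simp add: hardy_coeff_def taylor_coeff_def)

text \<open>Square summable sequences are exactly the coefficient sequences. This is the source of
  new elements: the monomials, the values of adjoints and the backward shift.\<close>

lemma ex_hardy_coeff: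
  assumes "summable (\<lambda>n. (cmod (a n))\<^sup>2)"
  shows "\<exists>f. hardy_coeff f = a"
proof
  have sums: "(\<lambda>n. a n * z ^ n) sums (\<Sum>n. a n * z ^ n)" if "z \<in> ball 0 1" for z
    by (rule summable_sums[OF square_summable_power_series[OF assms that]])
  have "in_hardy (\<lambda>z. \<Sum>n. a n * z ^ n)" by (rule in_hardyI[OF sums assms])
  then show "hardy_coeff (to_hardy (\<lambda>z. \<Sum>n. a n * z ^ n)) = a"
    using power_series_disc(2)[OF sums] by (simp add: hardy_coeff_to_hardy)
qed

lemma cinner_commute: "cinner g f = cnj (cinner f g)"
proof -
  have "(\<lambda>n. cnj (hardy_coeff f n * cnj (hardy_coeff g n))) sums cnj (cinner f g)"
    unfolding cinner_def by (intro sums_cnj[THEN iffD2] summable_sums summable_cinner)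
  from sums_unique[OF this] show ?thesis
    unfolding cinner_def[of g f] by (simp add: mult.commute)
qed

lemma cinner_add_left: "cinner (f + g) h = cinner f h + cinner g h"
  unfolding cinner_def hardy_coeff_plus ring_distribs
  by (rule suminf_add[OF summable_cinner summable_cinner, symmetric])

lemma cinner_scaleC_left: "cinner (c *\<^sub>C f) g = c * cinner f g"
  unfolding cinner_def hardy_coeff_scaleC mult.assoc
  by (rule suminf_mult[OF summable_cinner])

lemma cinner_add_right: "cinner h (f + g) = cinner h f + cinner h g"
  by (metis cinner_add_left cinner_commute complex_cnj_add)

lemma cinner_scaleC_right: "cinner g (c *\<^sub>C f) = cnj c * cinner g f"
  by (metis cinner_scaleC_left cinner_commute complex_cnj_mult)

lemma cinner_uminus_left: "cinner (- f) g = - cinner f g"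
  unfolding uminus_hardy_def cinner_scaleC_left by simp

lemma cinner_uminus_right: "cinner g (- f) = - cinner g f"
  unfolding uminus_hardy_def cinner_scaleC_right by simp

lemma cinner_diff_left: "cinner (f - g) h = cinner f h - cinner g h"
  unfolding minus_hardy_def cinner_add_left cinner_uminus_left by simp

lemma cinner_diff_right: "cinner h (f - g) = cinner h f - cinner h g"
  unfolding minus_hardy_def cinner_add_right cinner_uminus_right by simp

lemma cinner_zero_left [simp]: "cinner 0 f = 0"
  by (simp add: cinner_def)

lemma cinner_zero_right [simp]: "cinner f 0 = 0"
  by (simp add: cinner_def)

lemmas cinner_simps = cinner_add_left cinner_add_right cinner_scaleC_left cinner_scaleC_right
  cinner_uminus_left cinner_uminus_right cinner_diff_left cinner_diff_right

lemma cinner_sum_left: "cinner (sum f A) g = (\<Sum>i\<in>A. cinner (f i) g)"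
  by (induction A rule: infinite_finite_induct) (simp_all add: cinner_add_left)

lemma cinner_self: "cinner f f = complex_of_real ((norm f)\<^sup>2)"
proof -
  have "Im (cinner f f) = 0"
    using arg_cong[OF cinner_commute[of f f], of Im] by simp
  then show ?thesis
    by (simp add: complex_eq_iff norm_hardy_def flip: inner_hardy_def)
qed

lemma cinner_self_eq_0 [simp]: "cinner f f = 0 \<longleftrightarrow> f = 0"
  by (simp add: cinner_self)

lemma cinner_ext:
  assumes "\<And>h. cinner f h = cinner g h"
  shows "f = g"
  using assms[of "f - g"] cinner_self_eq_0[of "f - g"] by (simp add: cinner_diff_left)

lemma norm_scaleC: "norm (c *\<^sub>C f) = cmod c * norm f"
proof -
  have "complex_of_real ((norm (c *\<^sub>C f))\<^sup>2) = complex_of_real ((cmod c * norm f)\<^sup>2)"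
    unfolding cinner_self[symmetric] cinner_simps
    using complex_norm_square[of c] by (simp add: cinner_self power_mult_distrib)
  then have "(norm (c *\<^sub>C f))\<^sup>2 = (cmod c * norm f)\<^sup>2" by (rule of_real_eq_iff[THEN iffD1])
  then show ?thesis by (simp add: power2_eq_iff_nonneg)
qed

text \<open>The real inner product controls only the real part of \<open>cinner f g\<close>;
  rotating \<open>f\<close> by the unimodular \<open>c\<close> makes this number real and
  nonnegative.\<close>

lemma Cauchy_Schwarz_cinner: "cmod (cinner f g) \<le> norm f * norm g"
proof (cases "cinner f g = 0")
  case False
  define c where "c = cnj (sgn (cinner f g))"
  have c: "cmod c = 1" using False by (simp add: c_def norm_sgn)
  have "c * cinner f g = complex_of_real (cmod (cinner f g))"
    by (simp add: c_def sgn_eq scaleR_conv_of_real complex_norm_square[symmetric] False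
        power2_eq_square divide_simps mult.commute[of "cnj _"])
  then have "inner (c *\<^sub>C f) g = cmod (cinner f g)"
    by (simp add: inner_hardy_def cinner_simps)
  with norm_cauchy_schwarz[of "c *\<^sub>C f" g] show ?thesis
    by (simp add: norm_scaleC c)
qed simp

text \<open>The squared distance from the partial sum to \<open>f\<close> is a tail of the
  convergent series of squared coefficients.\<close>

lemma hardy_partial_sums_tendsto:
  fixes f :: hardy and e :: "nat \<Rightarrow> hardy"
  assumes e: "\<And>n m. hardy_coeff (e n) m = (if m = n then 1 else 0)"
  shows "(\<lambda>N. \<Sum>n<N. hardy_coeff f n *\<^sub>C e n) \<longlonglongrightarrow> f"
proof -
  define p where "p = (\<lambda>N. \<Sum>n<N. hardy_coeff f n *\<^sub>C e n)"
  define t where "t m = (cmod (hardy_coeff f m))\<^sup>2" for m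
  have t: "summable t"
    unfolding t_def by (rule square_summable_hardy_coeff)
  have p: "hardy_coeff (p N) m = (if m < N then hardy_coeff f m else 0)" for N m
    by (simp add: p_def e if_distrib[of "\<lambda>x. _ * x"] cong: if_cong)
  have "(norm (p N - f))\<^sup>2 = suminf t - sum t {..<N}" for N
  proof -
    have "(norm (p N - f))\<^sup>2 = (\<Sum>m. (cmod (hardy_coeff (p N - f) m))\<^sup>2)"
      by (simp only: power2_norm_eq_inner inner_hardy_self)
    also have "\<dots> = (\<Sum>m. t m - (if m < N then t m else 0))"
      by (rule suminf_cong) (simp add: p t_def)
    also have "\<dots> = suminf t - (\<Sum>m. if m < N then t m else 0)"
      by (rule suminf_diff[symmetric, OF t]) (rule summable_finite[of "{..<N}"], auto)
    also have "(\<Sum>m. if m < N then t m else 0) = (\<Sum>m<N. if m < N then t m else 0)"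
      by (rule suminf_finite) auto
    finally show ?thesis by simp
  qed
  moreover have "(\<lambda>N. suminf t - sum t {..<N}) \<longlonglongrightarrow> suminf t - suminf t"
    by (intro tendsto_intros summable_LIMSEQ t)
  ultimately have "(\<lambda>N. sqrt ((norm (p N - f))\<^sup>2)) \<longlonglongrightarrow> sqrt 0"
    by (intro tendsto_real_sqrt) simp
  then have "p \<longlonglongrightarrow> f"
    by (simp add: tendsto_norm_zero_iff LIM_zero_iff)
  then show ?thesis by (simp add: p_def)
qed


section \<open>Bounded operators and their adjoints\<close>

lemma bounded_operatorI:
  assumes "\<And>f g. T (f + g) = T f + T g" and "\<And>c f. T (c *\<^sub>C f) = c *\<^sub>C T f"
    and "\<And>f. norm (T f) \<le> norm f * K"
  shows "bounded_operator T"
  unfolding bounded_operator_def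
  by (auto intro!: bounded_linear_intro[of T K] simp: assms scaleR_hardy_def)

lemma
  assumes "bounded_operator T"
  shows bounded_operator_add: "T (f + g) = T f + T g"
    and bounded_operator_diff: "T (f - g) = T f - T g"
    and bounded_operator_scaleC: "T (c *\<^sub>C f) = c *\<^sub>C T f"
    and bounded_operator_sum: "T (sum h A) = (\<Sum>i\<in>A. T (h i))"
proof -
  interpret bounded_linear T using assms by (simp add: bounded_operator_def)
  show "T (f + g) = T f + T g" "T (f - g) = T f - T g"
    "T (sum h A) = (\<Sum>i\<in>A. T (h i))"
    by (fact add diff sum)+
  show "T (c *\<^sub>C f) = c *\<^sub>C T f" using assms by (simp add: bounded_operator_def)
qed

text \<open>The adjoint is built from its coefficients \<open>cinner g (T z^n)\<close>; boundedness of \<open>T\<close> applied to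
  their partial sums gives square summability, so no completeness of the space is needed.\<close>

lemma ex_adjoint:
  assumes T: "bounded_operator T"
  shows "\<exists>h. \<forall>f. cinner (T f) g = cinner f h"
proof -
  have "\<exists>f. hardy_coeff f = (\<lambda>m. if m = n then 1 else 0)" for n :: nat
    by (rule ex_hardy_coeff, rule summable_finite[of "{n}"]) auto
  then obtain e where "\<And>n. hardy_coeff (e n) = (\<lambda>m. if m = n then 1 else 0)" by metis
  then have e: "hardy_coeff (e n) m = (if m = n then 1 else 0)" for n m by simp
  obtain K where K: "\<And>f. norm (T f) \<le> norm f * K"
    using T bounded_linear.bounded unfolding bounded_operator_def by metis
  define c where "c n = cinner g (T (e n))" for n
  have sum_eq: "(\<Sum>n<N. x n * cnj (c n)) = cinner (T (\<Sum>n<N. x n *\<^sub>C e n)) g" for x N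
    by (simp add: c_def bounded_operator_sum[OF T] bounded_operator_scaleC[OF T] cinner_sum_left
        cinner_simps cinner_commute[of g])
  have c: "summable (\<lambda>n. (cmod (c n))\<^sup>2)"
  proof (rule summableI_nonneg_bounded)
    fix N
    let ?s = "\<Sum>n<N. (cmod (c n))\<^sup>2"
    define p where "p = (\<Sum>n<N. c n *\<^sub>C e n)"
    have pc: "hardy_coeff p m = (if m < N then c m else 0)" for m
      by (simp add: p_def e if_distrib[of "\<lambda>x. _ * x"] cong: if_cong)
    have np: "(norm p)\<^sup>2 = ?s"
    proof -
      have "(norm p)\<^sup>2 = (\<Sum>m. (cmod (hardy_coeff p m))\<^sup>2)"
        by (simp only: power2_norm_eq_inner inner_hardy_self)
      also have "\<dots> = (\<Sum>m<N. (cmod (hardy_coeff p m))\<^sup>2)"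
        by (rule suminf_finite) (auto simp: pc)
      finally show ?thesis by (simp add: pc)
    qed
    \<comment> \<open>Pairing \<open>T p\<close> with \<open>g\<close> returns the squared norm of
      \<open>p\<close>, by the choice of \<open>c\<close>; Cauchy-Schwarz and the bound on
      \<open>T\<close> then allow one factor \<open>norm p\<close> to be cancelled.\<close>
    have "complex_of_real ?s = cinner (T p) g"
      using sum_eq[of c N] by (simp add: p_def complex_norm_square del: of_real_power)
    from arg_cong[OF this, of cmod] have "?s = cmod (cinner (T p) g)"
      unfolding norm_of_real by (simp add: sum_nonneg)
    also have "\<dots> \<le> norm (T p) * norm g" by (rule Cauchy_Schwarz_cinner)
    also have "\<dots> \<le> norm p * K * norm g" by (intro mult_right_mono K) simp
    finally have "(norm p)\<^sup>2 \<le> norm p * K * norm g" unfolding np .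
    then have le: "norm p * norm p \<le> norm p * (K * norm g)"
      by (simp add: power2_eq_square mult.assoc)
    have "norm p \<le> \<bar>K * norm g\<bar>"
    proof (cases "norm p = 0")
      case False
      with le have "norm p \<le> K * norm g" by simp
      then show ?thesis by linarith
    qed simp
    then show "?s \<le> \<bar>K * norm g\<bar>\<^sup>2"
      unfolding np[symmetric] by (intro power_mono) simp_all
  qed simp
  obtain h where h: "hardy_coeff h = c" using ex_hardy_coeff[OF c] by blast
  have "cinner (T f) g = cinner f h" for f
  proof -
    let ?p = "\<lambda>N. \<Sum>n<N. hardy_coeff f n *\<^sub>C e n"
    have "(\<lambda>N. cinner (T (?p N)) g) \<longlonglongrightarrow> cinner f h"
      using summable_LIMSEQ[OF summable_cinner[of f h]] unfolding cinner_def[of f h] h sum_eq .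
    moreover have "(\<lambda>N. cinner (T (?p N)) g) \<longlonglongrightarrow> cinner (T f) g"
    proof (rule LIM_zero_cancel, rule Lim_null_comparison)
      have "bounded_linear T" using T by (simp add: bounded_operator_def)
      from bounded_linear.tendsto[OF this hardy_partial_sums_tendsto[where e = e, OF e, of f]]
      have "(\<lambda>N. T (?p N) - T f) \<longlonglongrightarrow> 0" by (rule LIM_zero)
      then have "(\<lambda>N. norm (T (?p N) - T f) * norm g) \<longlonglongrightarrow> norm (0::hardy) * norm g"
        by (intro tendsto_intros)
      then show "(\<lambda>N. norm (T (?p N) - T f) * norm g) \<longlonglongrightarrow> 0" by simp
      show "\<forall>\<^sub>F N in sequentially. norm (cinner (T (?p N)) g - cinner (T f) g) \<le> norm (T (?p N) - T f) * norm g"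
        by (simp add: Cauchy_Schwarz_cinner flip: cinner_diff_left)
    qed
    ultimately show ?thesis using LIMSEQ_unique by blast
  qed
  then show ?thesis by blast
qed

text \<open>Boundedness gives existence and nondegeneracy of the inner product gives uniqueness, so
  the description in \<open>adj\<close> denotes the adjoint.\<close>

lemma cinner_adj_right:
  assumes "bounded_operator T"
  shows "cinner f (adj T g) = cinner (T f) g"
proof -
  from ex_adjoint[OF assms] obtain A where A: "\<And>f g. cinner (T f) g = cinner f (A g)" by metis
  have "adj T = A"
    unfolding adj_def
  proof (rule the_equality)
    fix A' assume "\<forall>f g. cinner (T f) g = cinner f (A' g)"
    then have "cinner (A' g) f = cinner (A g) f" for f g
      by (metis A cinner_commute)
    then show "A' = A" by (intro ext cinner_ext)
  qed (use A in blast)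
  then show ?thesis by (simp add: A)
qed

lemma cinner_adj_left:
  assumes "bounded_operator T"
  shows "cinner (adj T g) f = cinner g (T f)"
  by (metis assms cinner_adj_right cinner_commute)

section \<open>The shift and Blaschke factors\<close>

lemma hardy_coeff_shift:
  "hardy_coeff (shift f) n = (case n of 0 \<Rightarrow> 0 | Suc m \<Rightarrow> hardy_coeff f m)"
proof -
  let ?a = "\<lambda>n. case n of 0 \<Rightarrow> 0 | Suc m \<Rightarrow> hardy_coeff f m"
  have "(\<lambda>n. ?a n * z ^ n) sums hardy_eval (shift f) z" if "z \<in> ball 0 1" for z
  proof -
    have "(\<lambda>n. ?a (Suc n) * z ^ Suc n) sums (z * hardy_eval f z)"
      using sums_mult[OF hardy_eval_sums[OF that], of z f] by (simp add: mult_ac)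
    then show ?thesis
      using that by (subst (asm) sums_Suc_iff) (simp add: hardy_eval_shift)
  qed
  from power_series_disc(2)[OF this] have "hardy_coeff (shift f) = ?a"
    unfolding hardy_coeff_def[of "shift f"] .
  then show ?thesis by simp
qed

lemma cinner_shift_shift: "cinner (shift f) (shift g) = cinner f g"
  using suminf_split_head[OF summable_cinner[of "shift f" "shift g"]]
  by (simp add: cinner_def hardy_coeff_shift)

lemma shift_add: "shift (f + g) = shift f + shift g"
  by (rule hardy_eqI) (simp add: hardy_eval_shift ring_distribs)

lemma shift_scaleC: "shift (c *\<^sub>C f) = c *\<^sub>C shift f"
  by (rule hardy_eqI) (simp add: hardy_eval_shift)

lemma bounded_operator_isometry:
  assumes "\<And>f g. T (f + g) = T f + T g" and "\<And>c f. T (c *\<^sub>C f) = c *\<^sub>C T f"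
    and "\<And>f g. cinner (T f) (T g) = cinner f g"
  shows "bounded_operator T"
proof (rule bounded_operatorI[where K = 1])
  fix f
  have "complex_of_real ((norm (T f))\<^sup>2) = complex_of_real ((norm f)\<^sup>2)"
    unfolding cinner_self[symmetric] by (rule assms)
  then have "(norm (T f))\<^sup>2 = (norm f)\<^sup>2" by (rule of_real_eq_iff[THEN iffD1])
  then show "norm (T f) \<le> norm f * 1" by (simp add: power2_eq_iff_nonneg)
qed (rule assms)+

lemma bounded_operator_shift: "bounded_operator shift"
  by (intro bounded_operator_isometry shift_add shift_scaleC cinner_shift_shift)

section \<open>Szego kernels and the backward shift\<close>

lemma hardy_coeff_szego:
  assumes "\<alpha> \<in> ball 0 1"
  shows "hardy_coeff (szego \<alpha>) n = cnj \<alpha> ^ n"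
proof -
  have "(\<lambda>n. cnj \<alpha> ^ n * z ^ n) sums (1 / (1 - cnj \<alpha> * z))" if "z \<in> ball 0 1" for z
  proof -
    have "norm (cnj \<alpha> * z) < 1"
      using assms that mult_strict_mono'[of "cmod \<alpha>" 1 "cmod z" 1] by (simp add: norm_mult)
    from geometric_sums[OF this] show ?thesis by (simp add: power_mult_distrib)
  qed
  from power_series_disc(2)[OF this] show ?thesis
    using hardy_coeff_to_hardy[OF in_hardy_divide[OF in_hardy_const[of 1], of \<alpha>]] assms
    by (simp add: szego_def)
qed

lemma cinner_szego:
  assumes "\<alpha> \<in> ball 0 1"
  shows "cinner f (szego \<alpha>) = hardy_eval f \<alpha>"
  using sums_unique[OF hardy_eval_sums[OF assms, of f]]
  by (simp add: cinner_def hardy_coeff_szego[OF assms])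

lemma cinner_szego_left:
  assumes "\<alpha> \<in> ball 0 1"
  shows "cinner (szego \<alpha>) f = cnj (hardy_eval f \<alpha>)"
  using cinner_commute[of "szego \<alpha>" f] by (simp add: cinner_szego[OF assms])

text \<open>\<open>szego 0\<close> serves as the constant function 1 from here on.\<close>

lemma hardy_eval_szego_0: "z \<in> ball 0 1 \<Longrightarrow> hardy_eval (szego 0) z = 1"
  by (simp add: hardy_eval_szego)

text \<open>The adjoint of the shift is the backward shift: the element \<open>g\<close> whose
  coefficients are those of \<open>f\<close> moved down by one has the same pairings as
  \<open>adj shift f\<close>, since constants are orthogonal to the range of the shift.\<close>

lemma hardy_shift_decomp: "f = hardy_eval f 0 *\<^sub>C szego 0 + shift (adj shift f)"
proof -
  define b where "b n = hardy_coeff f (Suc n)" for n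
  have b: "summable (\<lambda>n. (cmod (b n))\<^sup>2)"
    unfolding b_def using square_summable_hardy_coeff[of f] by (subst summable_Suc_iff)
  obtain g where g: "hardy_coeff g = b" using ex_hardy_coeff[OF b] by blast
  have f: "f = hardy_eval f 0 *\<^sub>C szego 0 + shift g"
    by (rule hardy_coeff_eqI)
      (simp add: hardy_coeff_szego hardy_coeff_shift g b_def power_0_left hardy_coeff_0 split: nat.split)
  have "adj shift f = g"
  proof (rule cinner_ext)
    fix h
    have "cinner (adj shift f) h = cinner (hardy_eval f 0 *\<^sub>C szego 0 + shift g) (shift h)"
      using f by (simp add: cinner_adj_left[OF bounded_operator_shift])
    also have "\<dots> = cinner g h"
      by (simp add: cinner_simps cinner_szego_left hardy_eval_shift cinner_shift_shift)
    finally show "cinner (adj shift f) h = cinner g h" .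
  qed
  with f show ?thesis by simp
qed

lemma hardy_eval_decomp:
  assumes "z \<in> ball 0 1"
  shows "hardy_eval f z = hardy_eval f 0 + z * hardy_eval (adj shift f) z"
  by (subst hardy_shift_decomp) (use assms in \<open>simp add: hardy_eval_szego_0 hardy_eval_shift\<close>)

section \<open>Multiplication by a Blaschke factor\<close>

lemma cnj_mult_ne_1:
  assumes "\<alpha> \<in> ball 0 1" and "z \<in> ball 0 1"
  shows "cnj \<alpha> * z \<noteq> 1"
proof
  assume "cnj \<alpha> * z = 1"
  then have "cmod \<alpha> * cmod z = 1" by (metis complex_mod_cnj norm_mult norm_one)
  moreover have "cmod \<alpha> * cmod z < 1"
    using assms mult_strict_mono'[of "cmod \<alpha>" 1 "cmod z" 1] by simp
  ultimately show False by simp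
qed

lemma blaschke_self [simp]: "blaschke \<alpha> \<alpha> = 0"
  by (simp add: blaschke_def)

context
  fixes \<alpha> :: complex
  assumes \<alpha>: "\<alpha> \<in> ball 0 1"
begin

lemmas disc_simps = \<alpha> \<alpha>[simplified]

lemma mult_blaschke_add:
  "mult_op (blaschke \<alpha>) (f + g) = mult_op (blaschke \<alpha>) f + mult_op (blaschke \<alpha>) g"
  by (rule hardy_eqI) (simp add: hardy_eval_mult_op_blaschke disc_simps ring_distribs)

lemma mult_blaschke_scaleC:
  "mult_op (blaschke \<alpha>) (c *\<^sub>C f) = c *\<^sub>C mult_op (blaschke \<alpha>) f"
  by (rule hardy_eqI) (simp add: hardy_eval_mult_op_blaschke disc_simps)

lemma mult_blaschke_shift:
  "mult_op (blaschke \<alpha>) (shift f) = shift (mult_op (blaschke \<alpha>) f)"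
  by (rule hardy_eqI) (simp add: hardy_eval_mult_op_blaschke hardy_eval_shift disc_simps)

text \<open>Clearing the denominator of the Blaschke factor expresses multiplication by it through
  the shift alone.\<close>

lemma mult_blaschke_denominator:
  "mult_op (blaschke \<alpha>) (g - cnj \<alpha> *\<^sub>C shift g) = shift g - \<alpha> *\<^sub>C g"
proof (rule hardy_eqI)
  fix z :: complex assume z: "z \<in> ball 0 1"
  have "blaschke \<alpha> z * (1 - cnj \<alpha> * z) = z - \<alpha>"
    using cnj_mult_ne_1[OF \<alpha> z] by (simp add: blaschke_def)
  then have "blaschke \<alpha> z * (1 - cnj \<alpha> * z) * hardy_eval g z = (z - \<alpha>) * hardy_eval g z"
    by simp
  then show "hardy_eval (mult_op (blaschke \<alpha>) (g - cnj \<alpha> *\<^sub>C shift g)) z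
      = hardy_eval (shift g - \<alpha> *\<^sub>C g) z"
    using z by (simp add: hardy_eval_mult_op_blaschke hardy_eval_shift disc_simps algebra_simps)
qed

text \<open>Dividing by \<open>1 - cnj \<alpha> * z\<close> preserves the Hardy space, so the form
  required by \<open>mult_blaschke_denominator\<close> is available for every element.\<close>

lemma ex_hardy_denominator: "\<exists>g. f = g - cnj \<alpha> *\<^sub>C shift g"
proof
  let ?g = "to_hardy (\<lambda>z. hardy_eval f z / (1 - cnj \<alpha> * z))"
  have g: "in_hardy (\<lambda>z. hardy_eval f z / (1 - cnj \<alpha> * z))"
    using \<alpha> by (intro in_hardy_divide in_hardy_eval) simp
  show "f = ?g - cnj \<alpha> *\<^sub>C shift ?g"
  proof (rule hardy_eqI)
    fix z :: complex assume z: "z \<in> ball 0 1"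
    have "hardy_eval ?g z * (1 - cnj \<alpha> * z) = hardy_eval f z"
      using cnj_mult_ne_1[OF \<alpha> z] z by (simp add: hardy_eval_to_hardy[OF g])
    then show "hardy_eval f z = hardy_eval (?g - cnj \<alpha> *\<^sub>C shift ?g) z"
      using z by (simp add: hardy_eval_shift algebra_simps)
  qed
qed

text \<open>A Blaschke factor is inner because \<open>S - \<alpha>\<close> and \<open>1 - cnj \<alpha> S\<close> have the same Gram form.\<close>

lemma cinner_mult_blaschke:
  "cinner (mult_op (blaschke \<alpha>) f) (mult_op (blaschke \<alpha>) h) = cinner f h"
proof -
  obtain a b where ab: "f = a - cnj \<alpha> *\<^sub>C shift a" "h = b - cnj \<alpha> *\<^sub>C shift b"
    using ex_hardy_denominator by metis
  show ?thesis
    unfolding ab mult_blaschke_denominator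
    by (simp add: cinner_simps cinner_shift_shift algebra_simps)
qed

lemma bounded_operator_mult_blaschke: "bounded_operator (mult_op (blaschke \<alpha>))"
  by (intro bounded_operator_isometry mult_blaschke_add mult_blaschke_scaleC cinner_mult_blaschke)

lemma mult_blaschke_szego: "mult_op (blaschke \<alpha>) (szego 0) = shift (szego \<alpha>) - \<alpha> *\<^sub>C szego \<alpha>"
  by (rule hardy_eqI) (simp add: hardy_eval_mult_op_blaschke hardy_eval_shift hardy_eval_szego
      disc_simps blaschke_def diff_divide_distrib)

text \<open>\<open>f - B B\<^sup>* f\<close> lies in the kernel of \<open>B\<^sup>*\<close>, which consists of the multiples of the Szego
  kernel; since it is also orthogonal to that kernel, it vanishes.\<close>

lemma ex_mult_blaschke:
  assumes "hardy_eval f \<alpha> = 0"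
  shows "\<exists>g. f = mult_op (blaschke \<alpha>) g"
proof
  let ?B = "mult_op (blaschke \<alpha>)"
  define h where "h = f - ?B (adj ?B f)"
  have "cinner h (?B x) = 0" for x
    by (simp add: h_def cinner_diff_left cinner_mult_blaschke cinner_adj_left[OF bounded_operator_mult_blaschke])
  then have "cinner h (shift g - \<alpha> *\<^sub>C g) = 0" for g
    by (metis mult_blaschke_denominator)
  \<comment> \<open>Orthogonality to the range of S - \<alpha> makes \<open>h\<close> an eigenvector
    of the backward shift; the decomposition of \<open>h\<close> then reads (1 - cnj \<alpha> z)
    h(z) = h(0).\<close>
  then have S: "adj shift h = cnj \<alpha> *\<^sub>C h"
    by (intro cinner_ext) (simp add: cinner_simps cinner_adj_left[OF bounded_operator_shift])
  have h: "h = hardy_eval h 0 *\<^sub>C szego \<alpha>"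
  proof (rule hardy_eqI)
    fix z :: complex assume z: "z \<in> ball 0 1"
    from hardy_eval_decomp[OF z, of h] cnj_mult_ne_1[OF \<alpha> z]
    show "hardy_eval h z = hardy_eval (hardy_eval h 0 *\<^sub>C szego \<alpha>) z"
      using z \<alpha> by (simp add: S hardy_eval_szego field_simps)
  qed
  have "hardy_eval h \<alpha> = 0"
    using \<alpha> assms by (simp add: h_def hardy_eval_mult_op_blaschke)
  then have "cinner h (hardy_eval h 0 *\<^sub>C szego \<alpha>) = 0"
    by (simp add: cinner_simps cinner_szego[OF \<alpha>])
  with h have "h = 0" by (metis cinner_self_eq_0)
  then show "f = ?B (adj ?B f)" by (simp add: h_def)
qed

lemma mult_blaschke_squared:
  "mult_op (\<lambda>z. (blaschke \<alpha> z)\<^sup>2) f = mult_op (blaschke \<alpha>) (mult_op (blaschke \<alpha>) f)"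
  by (rule hardy_eqI)
    (simp add: hardy_eval_mult_op_blaschke_squared hardy_eval_mult_op_blaschke disc_simps, simp add: power2_eq_square)

lemma to_hardy_blaschke_squared:
  "to_hardy (\<lambda>z. (blaschke \<alpha> z)\<^sup>2) = mult_op (blaschke \<alpha>) (mult_op (blaschke \<alpha>) (szego 0))"
  by (rule hardy_eqI)
    (simp add: hardy_eval_blaschke_squared hardy_eval_mult_op_blaschke hardy_eval_szego_0 disc_simps, simp add: power2_eq_square)

text \<open>A zero at \<alpha> can be divided out by \<open>ex_mult_blaschke\<close>. Since
  multiplication by the Blaschke factor is isometric, the second orthogonality says that the
  quotient vanishes at \<alpha> too, so the division can be repeated.\<close>

lemma in_range_mult_blaschke_squared_iff:
  "f \<in> range (mult_op (\<lambda>z. (blaschke \<alpha> z)\<^sup>2)) \<longleftrightarrow>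
     cinner f (szego \<alpha>) = 0 \<and> cinner f (mult_op (blaschke \<alpha>) (szego \<alpha>)) = 0"
proof
  assume "f \<in> range (mult_op (\<lambda>z. (blaschke \<alpha> z)\<^sup>2))"
  then obtain h where "f = mult_op (blaschke \<alpha>) (mult_op (blaschke \<alpha>) h)"
    by (auto simp: mult_blaschke_squared)
  then show "cinner f (szego \<alpha>) = 0 \<and> cinner f (mult_op (blaschke \<alpha>) (szego \<alpha>)) = 0"
    by (simp add: cinner_mult_blaschke cinner_szego[OF \<alpha>] hardy_eval_mult_op_blaschke[OF \<alpha> \<alpha>])
next
  assume *: "cinner f (szego \<alpha>) = 0 \<and> cinner f (mult_op (blaschke \<alpha>) (szego \<alpha>)) = 0"
  then have "hardy_eval f \<alpha> = 0" by (simp add: cinner_szego[OF \<alpha>])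
  from ex_mult_blaschke[OF this] obtain g where g: "f = mult_op (blaschke \<alpha>) g" by blast
  with * have "hardy_eval g \<alpha> = 0" by (simp add: cinner_mult_blaschke cinner_szego[OF \<alpha>])
  from ex_mult_blaschke[OF this] obtain h where "g = mult_op (blaschke \<alpha>) h" by blast
  with g show "f \<in> range (mult_op (\<lambda>z. (blaschke \<alpha> z)\<^sup>2))"
    by (auto simp: mult_blaschke_squared)
qed

end


section \<open>Two-dimensional subspaces and matrices\<close>

lemma span_pair: "x \<in> hardy.span {a, b} \<longleftrightarrow> (\<exists>c d. x = c *\<^sub>C a + d *\<^sub>C b)"
  by (auto simp: hardy.span_insert hardy.span_singleton diff_eq_eq add.commute)

text \<open>The last hypothesis puts \<open>f\<close> in the double orthogonal complement of the
  pair. Its projection \<open>p\<close> leaves a remainder orthogonal to \<open>p\<close> and to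
  \<open>f\<close>, hence to itself.\<close>

lemma orthogonal_pair_expansion:
  assumes "cinner e1 e2 = 0" and "e1 \<noteq> 0" and "e2 \<noteq> 0"
    and "\<And>h. cinner h e1 = 0 \<Longrightarrow> cinner h e2 = 0 \<Longrightarrow> cinner f h = 0"
  shows "f = (cinner f e1 / cinner e1 e1) *\<^sub>C e1 + (cinner f e2 / cinner e2 e2) *\<^sub>C e2"
proof -
  have 21: "cinner e2 e1 = 0" using assms(1) cinner_commute[of e2 e1] by simp
  define p where "p = (cinner f e1 / cinner e1 e1) *\<^sub>C e1 + (cinner f e2 / cinner e2 e2) *\<^sub>C e2"
  have 0: "cinner (f - p) e1 = 0" "cinner (f - p) e2 = 0"
    using assms(1-3) 21 by (simp_all add: p_def cinner_simps)
  then have "cinner (f - p) p = 0" by (simp add: p_def cinner_add_right cinner_scaleC_right)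
  moreover have "cinner (f - p) f = 0"
    using assms(4)[OF 0] cinner_commute[of "f - p" f] by simp
  ultimately have "cinner (f - p) (f - p) = 0" by (simp only: cinner_diff_right) simp
  then show ?thesis by (simp add: p_def)
qed

section \<open>Normal and quasinormal matrices\<close>

abbreviation conj_transpose :: "complex^'n^'m \<Rightarrow> complex^'m^'n" where
  "conj_transpose A \<equiv> map_matrix cnj (transpose A)"

lemma conj_transpose_matrix_mult:
  "conj_transpose (A ** B) = conj_transpose B ** conj_transpose A"
  by (simp add: vec_eq_iff map_matrix_def transpose_def matrix_matrix_mult_def mult.commute)

text \<open>The trace is the squared Frobenius norm, the sum of the squared moduli of the
  entries.\<close>

lemma trace_mult_conj_transpose_eq_0:
  fixes A :: "complex^'n^'n"
  assumes "trace (A ** conj_transpose A) = 0"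
  shows "A = 0"
proof -
  have "complex_of_real (\<Sum>i\<in>UNIV. \<Sum>j\<in>UNIV. (cmod (A $ i $ j))\<^sup>2) = trace (A ** conj_transpose A)"
    by (simp add: trace_def matrix_matrix_mult_def map_matrix_def transpose_def complex_norm_square
        del: of_real_power)
  with assms have "(\<Sum>i\<in>UNIV. \<Sum>j\<in>UNIV. (cmod (A $ i $ j))\<^sup>2) = 0" by (metis of_real_eq_0_iff)
  then show ?thesis by (simp add: sum_nonneg_eq_0_iff sum_nonneg vec_eq_iff)
qed

text \<open>With \<open>P = A\<^sup>* A\<close> and \<open>Q = A A\<^sup>*\<close>, the traces of \<open>P\<^sup>2\<close>, \<open>Q\<^sup>2\<close> and \<open>P Q\<close> all agree, so the
  Hermitian matrix \<open>P - Q\<close> has Frobenius norm 0.\<close>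

lemma normal_matrix_iff_quasinormal:
  fixes A :: "complex^'n^'n"
  shows "normal_matrix A \<longleftrightarrow> A ** (conj_transpose A ** A) = (conj_transpose A ** A) ** A"
proof
  assume "normal_matrix A"
  then show "A ** (conj_transpose A ** A) = (conj_transpose A ** A) ** A"
    by (simp add: normal_matrix_def matrix_mul_assoc)
next
  let ?A' = "conj_transpose A"
  assume q: "A ** (?A' ** A) = (?A' ** A) ** A"
  define P where "P = ?A' ** A"
  define Q where "Q = A ** ?A'"
  have sa: "conj_transpose P = P" "conj_transpose Q = Q"
    by (simp_all add: P_def Q_def conj_transpose_matrix_mult)
      (simp_all add: map_matrix_def transpose_def)
  have "trace (Q ** Q) = trace (P ** P)"
    using trace_mul_sym[of "A ** ?A' ** A" ?A'] by (simp add: P_def Q_def matrix_mul_assoc)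
  \<comment> \<open>Quasinormality enters here: it turns \<open>P ** Q\<close> into
    \<open>A ** P ** conj_transpose A\<close>, and the trace is cyclic.\<close>
  moreover have PQ: "trace (P ** Q) = trace (P ** P)"
  proof -
    have "P ** Q = A ** (?A' ** A) ** ?A'" unfolding q P_def Q_def by (simp add: matrix_mul_assoc)
    then show ?thesis
      using trace_mul_sym[of "A ** (?A' ** A)" ?A'] by (simp add: P_def matrix_mul_assoc)
  qed
  moreover have "trace (Q ** P) = trace (P ** P)"
    using PQ trace_mul_sym[of P Q] by simp
  moreover have "(P - Q) ** (P - Q) = (P ** P - P ** Q) - (Q ** P - Q ** Q)"
    by (simp add: vec_eq_iff matrix_matrix_mult_def ring_distribs sum_subtractf sum.distrib)
  ultimately have "trace ((P - Q) ** (P - Q)) = 0"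
    by (simp add: trace_sub)
  moreover have "conj_transpose (P - Q) = conj_transpose P - conj_transpose Q"
    by (simp add: vec_eq_iff map_matrix_def transpose_def)
  ultimately have "P - Q = 0"
    by (intro trace_mult_conj_transpose_eq_0) (simp add: sa)
  then show "normal_matrix A" by (simp add: normal_matrix_def P_def Q_def)
qed

section \<open>Rank-one perturbations of the shift\<close>

lemma bounded_operator_shift_plus_rank_one: "bounded_operator (\<lambda>f. shift f + rank_one u v f)"
proof -
  have "bounded_operator (rank_one u v)"
  proof (rule bounded_operatorI)
    show "rank_one u v (f + g) = rank_one u v f + rank_one u v g" for f g
      by (simp add: rank_one_def cinner_add_left hardy.scale_left_distrib)
    show "rank_one u v (c *\<^sub>C f) = c *\<^sub>C rank_one u v f" for c f
      by (simp add: rank_one_def cinner_scaleC_left)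
    show "norm (rank_one u v f) \<le> norm f * (norm v * norm u)" for f
      using mult_right_mono[OF Cauchy_Schwarz_cinner[of f v], of "norm u"]
      by (simp add: rank_one_def norm_scaleC mult.assoc)
  qed
  with bounded_operator_shift show ?thesis
    by (simp add: bounded_operator_def bounded_linear_add hardy.scale_right_distrib)
qed

text \<open>Commuting with T is the same condition for this operator as for T* T, but for a rank-one
  perturbation of the shift it has finite rank.\<close>

definition defect :: "(hardy \<Rightarrow> hardy) \<Rightarrow> hardy \<Rightarrow> hardy" where
  "defect T f = f - adj T (T f)"

lemma cinner_defect_left:
  "bounded_operator T \<Longrightarrow> cinner (defect T f) g = cinner f g - cinner (T f) (T g)"
  by (simp add: defect_def cinner_diff_left cinner_adj_left)

lemma cinner_defect_right:
  "bounded_operator T \<Longrightarrow> cinner f (defect T g) = cinner f g - cinner (T f) (T g)"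
  by (simp add: defect_def cinner_diff_right cinner_adj_right)

lemma quasinormal_iff_defect:
  assumes "bounded_operator T"
  shows "quasinormal T \<longleftrightarrow> (\<forall>f. T (defect T f) = defect T (T f))"
  using assms by (auto simp: quasinormal_def defect_def bounded_operator_diff fun_eq_iff)

text \<open>The shift is isometric, so its contribution to the form of T* T cancels the identity;
  every remaining term involves \<open>u\<close> only through its norm and
  \<open>adj shift u\<close>.\<close>

lemma defect_shift_plus_rank_one:
  "defect (\<lambda>f. shift f + rank_one u v f) f
     = - (cinner f v *\<^sub>C adj shift u + (cinner f (adj shift u) + cinner u u * cinner f v) *\<^sub>C v)"
proof (rule cinner_ext)
  fix h
  show "cinner (defect (\<lambda>f. shift f + rank_one u v f) f) h = cinner
    (- (cinner f v *\<^sub>C adj shift u + (cinner f (adj shift u) + cinner u u * cinner f v) *\<^sub>C v)) h"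
    unfolding cinner_defect_left[OF bounded_operator_shift_plus_rank_one]
    by (simp add: rank_one_def cinner_simps cinner_shift_shift cinner_adj_left[OF bounded_operator_shift]
        cinner_adj_right[OF bounded_operator_shift] cinner_commute[of v h] algebra_simps)
qed

text \<open>Independence kills both coefficients, first \<open>cinner f v\<close> and then what is
  left of the other. The hypothesis \<open>v \<noteq> adj shift u\<close> keeps the set from
  collapsing to a singleton.\<close>

lemma defect_shift_plus_rank_one_eq_0_iff:
  assumes "v \<noteq> adj shift u" and "hardy.independent {v, adj shift u}"
  shows "defect (\<lambda>f. shift f + rank_one u v f) f = 0 \<longleftrightarrow> cinner f v = 0 \<and> cinner f (adj shift u) = 0"
proof
  let ?w = "adj shift u"
  have v: "v \<noteq> 0" using assms(2) hardy.dependent_zero[of "{v, ?w}"] by auto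
  have w: "?w \<noteq> c *\<^sub>C v" for c
    using assms by (auto simp: insert_commute[of v ?w] hardy.independent_insert hardy.span_singleton)
  let ?x = "cinner f ?w + cinner u u * cinner f v"
  assume "defect (\<lambda>f. shift f + rank_one u v f) f = 0"
  then have 0: "cinner f v *\<^sub>C ?w + ?x *\<^sub>C v = 0" by (simp only: defect_shift_plus_rank_one neg_equal_0_iff_equal)
  have "cinner f v = 0"
  proof (rule ccontr)
    assume "cinner f v \<noteq> 0"
    then have "?w = inverse (cinner f v) *\<^sub>C (cinner f v *\<^sub>C ?w)" by simp
    also have "cinner f v *\<^sub>C ?w = (- ?x) *\<^sub>C v"
      using 0 by (simp only: hardy.scale_minus_left eq_neg_iff_add_eq_0)
    finally have "?w = (inverse (cinner f v) * (- ?x)) *\<^sub>C v" unfolding hardy.scale_scale .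
    with w show False by (rule notE)
  qed
  with 0 v show "cinner f v = 0 \<and> cinner f ?w = 0" by simp
qed (simp add: defect_shift_plus_rank_one)

section \<open>The model space and the kernel of the defect\<close>

lemma orthogonal_span_pair:
  assumes "x \<in> hardy.span {a, b}" and "cinner h a = 0" and "cinner h b = 0"
  shows "cinner h x = 0" and "cinner x h = 0"
proof -
  show "cinner h x = 0" using assms by (auto simp: span_pair cinner_simps)
  then show "cinner x h = 0" using cinner_commute[of x h] by simp
qed

text \<open>Otherwise a vector of the second pair would extend the first to three independent
  vectors inside a span of at most two.\<close>

lemma span_pair_exchange:
  assumes "v \<noteq> w" and "hardy.independent {v, w}" and "{v, w} \<subseteq> hardy.span {a, b}"
  shows "{a, b} \<subseteq> hardy.span {v, w}"
proof
  fix x assume x: "x \<in> {a, b}"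
  show "x \<in> hardy.span {v, w}"
  proof (rule ccontr)
    assume n: "x \<notin> hardy.span {v, w}"
    then have "x \<notin> {v, w}" using hardy.span_superset by blast
    with assms(1) have "card (insert x {v, w}) = 3" by simp
    moreover have "hardy.independent (insert x {v, w})"
      using n assms(2) by (rule hardy.independent_insertI)
    moreover have "insert x {v, w} \<subseteq> hardy.span {a, b}"
      using x assms(3) by (auto intro: hardy.span_base)
    moreover have "card {a, b} \<le> 2" using card_insert_le_m1[of 2 "{b}" a] by simp
    ultimately show False using hardy.independent_span_bound[of "{a, b}" "insert x {v, w}"] by simp
  qed
qed

context
  fixes \<alpha> :: complex
  assumes \<alpha>: "\<alpha> \<in> ball 0 1"
begin

lemma cinner_szego_self: "(1 - (complex_of_real (cmod \<alpha>))\<^sup>2) * cinner (szego \<alpha>) (szego \<alpha>) = 1"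
proof -
  have "(complex_of_real (cmod \<alpha>))\<^sup>2 = cnj \<alpha> * \<alpha>"
    using complex_norm_square[of \<alpha>] by (simp add: mult.commute)
  then show ?thesis
    using cnj_mult_ne_1[OF \<alpha> \<alpha>] by (simp add: cinner_szego[OF \<alpha>] hardy_eval_szego[OF \<alpha> \<alpha>])
qed

lemma cinner_model_basis:
  "cinner (mult_op (blaschke \<alpha>) (szego \<alpha>)) (szego \<alpha>) = 0"
  "cinner (szego \<alpha>) (mult_op (blaschke \<alpha>) (szego \<alpha>)) = 0"
  by (simp_all add: cinner_szego[OF \<alpha>] cinner_szego_left[OF \<alpha>] hardy_eval_mult_op_blaschke[OF \<alpha> \<alpha>])

text \<open>The basis is orthogonal, and both vectors have squared norm 1/(1 - |\<alpha>|^2) because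
  multiplication by the Blaschke factor is isometric; hence the common factor in the
  coefficients.\<close>

lemma mem_model_space:
  assumes "\<And>h. cinner h (szego \<alpha>) = 0 \<Longrightarrow> cinner h (mult_op (blaschke \<alpha>) (szego \<alpha>)) = 0
    \<Longrightarrow> cinner f h = 0"
  shows "f = ((1 - (complex_of_real (cmod \<alpha>))\<^sup>2) * cinner f (szego \<alpha>)) *\<^sub>C szego \<alpha>
    + ((1 - (complex_of_real (cmod \<alpha>))\<^sup>2) * cinner f (mult_op (blaschke \<alpha>) (szego \<alpha>)))
      *\<^sub>C mult_op (blaschke \<alpha>) (szego \<alpha>)"
proof -
  let ?k = "szego \<alpha>" and ?e = "mult_op (blaschke \<alpha>) (szego \<alpha>)"
    and ?s = "1 - (complex_of_real (cmod \<alpha>))\<^sup>2"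
  have e: "cinner ?e ?e = cinner ?k ?k" by (rule cinner_mult_blaschke[OF \<alpha>])
  have k: "cinner ?k ?k \<noteq> 0" using cinner_szego_self by auto
  have div: "x / cinner ?k ?k = ?s * x" for x
    using k cinner_szego_self by (simp add: divide_eq_eq mult_ac)
  have "f = (cinner f ?k / cinner ?k ?k) *\<^sub>C ?k + (cinner f ?e / cinner ?e ?e) *\<^sub>C ?e"
    by (rule orthogonal_pair_expansion) (use cinner_model_basis assms k e in auto)
  then show ?thesis unfolding e div .
qed

text \<open>Both sets are orthogonal complements, of \<open>v\<close> and \<open>adj shift u\<close>
  and of the model basis. Equal complements put the first pair into the double complement of the
  second; conversely, exchange makes the two spans equal.\<close>

lemma defect_kernel_iff:
  assumes "v \<noteq> adj shift u" and "hardy.independent {v, adj shift u}"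
  shows "{f. defect (\<lambda>f. shift f + rank_one u v f) f = 0} = range (mult_op (\<lambda>z. (blaschke \<alpha> z)\<^sup>2))
    \<longleftrightarrow> {v, adj shift u} \<subseteq> hardy.span {szego \<alpha>, mult_op (blaschke \<alpha>) (szego \<alpha>)}"
    (is "?K = ?R \<longleftrightarrow> ?V \<subseteq> hardy.span ?E")
proof
  assume eq: "?K = ?R"
  have "x \<in> hardy.span ?E" if "x \<in> ?V" for x
  proof -
    have "cinner x h = 0" if h: "cinner h (szego \<alpha>) = 0" "cinner h (mult_op (blaschke \<alpha>) (szego \<alpha>)) = 0" for h
    proof -
      have "h \<in> ?R" using h by (simp only: in_range_mult_blaschke_squared_iff[OF \<alpha>])
      then have "cinner h x = 0"
        unfolding eq[symmetric] using \<open>x \<in> ?V\<close> defect_shift_plus_rank_one_eq_0_iff[OF assms] by auto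
      then show ?thesis using cinner_commute[of x h] by simp
    qed
    from mem_model_space[OF this] show ?thesis unfolding span_pair by blast
  qed
  then show "?V \<subseteq> hardy.span ?E" by blast
next
  assume sub: "?V \<subseteq> hardy.span ?E"
  show "?K = ?R"
    using sub span_pair_exchange[OF assms sub] orthogonal_span_pair
    unfolding set_eq_iff in_range_mult_blaschke_squared_iff[OF \<alpha>] mem_Collect_eq
      defect_shift_plus_rank_one_eq_0_iff[OF assms]
    by (metis insert_subset)
qed

end

text \<open>The numbers \<open>a\<close> and \<open>b\<close> are the inner products of the two
  model basis vectors with \<open>v\<close>, hence the coefficients of \<open>u\<close> in the
  images of these vectors under \<open>T\<close>.\<close>

lemma quasinormal_shift_plus_rank_one_iff:
  fixes u v :: hardy and \<alpha> :: complex
  defines "T \<equiv> \<lambda>f. shift f + rank_one u v f"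
  assumes \<alpha>: "\<alpha> \<in> ball 0 1"
    and indep: "v \<noteq> adj shift u" "hardy.independent {v, adj shift u}"
    and sub: "{v, adj shift u} \<subseteq> hardy.span {szego \<alpha>, mult_op (blaschke \<alpha>) (szego \<alpha>)}"
    and R: "R = (1 - (complex_of_real (cmod \<alpha>))\<^sup>2) * hardy_eval (adj shift u) \<alpha> - cnj \<alpha> * hardy_eval u 0"
    and a: "a = cnj (hardy_eval v \<alpha>)"
    and b: "b = cnj (hardy_eval (adj (mult_op (blaschke \<alpha>)) v) \<alpha>)"
  shows "quasinormal T \<longleftrightarrow>
    cnj a + \<alpha> * cnj b = 0 \<and> b * cinner u (to_hardy (\<lambda>z. (blaschke \<alpha> z)\<^sup>2)) + 1 = 0 \<and>
    normal_matrix (vector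
      [vector [a * hardy_eval u 0 + \<alpha> * (1 + a * R), b * hardy_eval u 0 + \<alpha> * b * R],
       vector [1 + a * R,                            b * R]] :: complex^2^2)"
proof -

  \<comment> \<open>Notation and elementary inner products\<close>
  define B where "B = mult_op (blaschke \<alpha>)"
  define w where "w = adj shift u"
  define k where "k = szego \<alpha>"
  define one where "one = szego 0"
  define s where "s = 1 - (complex_of_real (cmod \<alpha>))\<^sup>2"
  define U where "U = cinner u (B (B one))"
  define A :: "complex^2^2" where "A = vector
      [vector [a * hardy_eval u 0 + \<alpha> * (1 + a * R), b * hardy_eval u 0 + \<alpha> * b * R],
       vector [1 + a * R,                            b * R]]"
  note bT = bounded_operator_shift_plus_rank_one[of u v, folded T_def]
  note bS = bounded_operator_shift
  have T: "T f = shift f + cinner f v *\<^sub>C u" for f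
    by (simp add: T_def rank_one_def)
  have U_eq: "cinner u (to_hardy (\<lambda>z. (blaschke \<alpha> z)\<^sup>2)) = U"
    by (simp add: U_def B_def one_def to_hardy_blaschke_squared[OF \<alpha>])
  have BB: "cinner (B f) (B h) = cinner f h" for f h
    by (simp add: B_def cinner_mult_blaschke[OF \<alpha>])
  have SS: "cinner (shift f) (shift h) = cinner f h" for f h
    by (rule cinner_shift_shift)
  have SB: "shift (B f) = B (shift f)" for f
    by (simp add: B_def mult_blaschke_shift[OF \<alpha>])
  have Badd: "B (f + h) = B f + B h" and Bscale: "B (c *\<^sub>C f) = c *\<^sub>C B f" for f h c
    by (simp_all add: B_def mult_blaschke_add[OF \<alpha>] mult_blaschke_scaleC[OF \<alpha>])
  have Bev: "hardy_eval (B f) z = blaschke \<alpha> z * hardy_eval f z" if "z \<in> ball 0 1" for f z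
    using hardy_eval_mult_op_blaschke[OF \<alpha> that] by (simp add: B_def)
  have ck: "cinner f k = hardy_eval f \<alpha>" "cinner k f = cnj (hardy_eval f \<alpha>)" for f
    by (simp_all add: k_def cinner_szego[OF \<alpha>] cinner_szego_left[OF \<alpha>])
  have c1: "cinner one f = cnj (hardy_eval f 0)" for f
    by (simp add: one_def cinner_szego_left)
  have one_ev: "hardy_eval one z = 1" if "z \<in> ball 0 1" for z
    using that by (simp only: one_def hardy_eval_szego_0)
  have Sk: "shift k = B one + \<alpha> *\<^sub>C k"
    by (simp add: B_def one_def k_def mult_blaschke_szego[OF \<alpha>])
  have s_eq: "s = 1 - cnj \<alpha> * \<alpha>"
    using complex_norm_square[of \<alpha>] by (simp add: s_def mult.commute)
  have cnj_s: "cnj s = s" by (simp add: s_def)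
  have sk: "s * cinner k k = 1"
    using cinner_szego_self[OF \<alpha>] by (simp add: s_def k_def)
  then have kk: "s * hardy_eval k \<alpha> = 1" by (simp add: ck)
  \<comment> \<open>This is the identity 1 - |\<alpha>|^2 = (1 - cnj \<alpha> z) + cnj \<alpha> (z -
    \<alpha>), divided by 1 - cnj \<alpha> z and multiplied by the Blaschke factor.\<close>
  have sBk: "s *\<^sub>C B k = B one + cnj \<alpha> *\<^sub>C B (B one)"
  proof -
    have "s *\<^sub>C k = one + cnj \<alpha> *\<^sub>C B one"
    proof (rule hardy_eqI)
      fix z :: complex assume z: "z \<in> ball 0 1"
      have "s = (1 - cnj \<alpha> * z) + cnj \<alpha> * (z - \<alpha>)" by (simp add: s_eq algebra_simps)
      also have "\<dots> / (1 - cnj \<alpha> * z) = 1 + cnj \<alpha> * blaschke \<alpha> z"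
        using cnj_mult_ne_1[OF \<alpha> z] by (simp add: add_divide_distrib blaschke_def)
      finally show "hardy_eval (s *\<^sub>C k) z = hardy_eval (one + cnj \<alpha> *\<^sub>C B one) z"
        by (simp add: k_def hardy_eval_szego[OF \<alpha> z] Bev[OF z] one_ev[OF z])
    qed
    then have "B (s *\<^sub>C k) = B (one + cnj \<alpha> *\<^sub>C B one)" by simp
    then show ?thesis by (simp add: Badd Bscale)
  qed
  have Bkv: "cinner (B k) v = b"
    by (simp add: b B_def k_def cinner_adj_right[OF bounded_operator_mult_blaschke[OF \<alpha>], symmetric]
        cinner_szego_left[OF \<alpha>])
  have Bk_\<alpha>: "hardy_eval (B f) \<alpha> = 0" for f by (simp add: Bev[OF \<alpha>])
  have u_\<alpha>: "hardy_eval u \<alpha> = hardy_eval u 0 + \<alpha> * hardy_eval w \<alpha>"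
    unfolding w_def by (rule hardy_eval_decomp[OF \<alpha>])
  have Se: "hardy_eval (shift f) \<alpha> = \<alpha> * hardy_eval f \<alpha>" for f
    by (rule hardy_eval_shift[OF \<alpha>])
  have uS: "cinner u (shift f) = cinner w f" for f
    by (simp add: w_def cinner_adj_left[OF bS])
  have B_0: "hardy_eval (B one) 0 = - \<alpha>"
    by (simp add: Bev one_ev blaschke_def)

  \<comment> \<open>The model space and its orthogonal complement\<close>
  define perp where "perp h \<longleftrightarrow> cinner h k = 0 \<and> cinner h (B k) = 0" for h
  have perp_iff: "perp h \<longleftrightarrow> (\<exists>g. h = B (B g))" for h
    using in_range_mult_blaschke_squared_iff[OF \<alpha>, of h]
    by (auto simp: perp_def k_def B_def mult_blaschke_squared[OF \<alpha>])
  have perp_S: "perp (shift h)" if "perp h" for h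
    using that by (auto simp: perp_iff SB)
  have defect_0: "defect T h = 0 \<longleftrightarrow> perp h" for h
    using defect_kernel_iff[OF \<alpha> indep] sub in_range_mult_blaschke_squared_iff[OF \<alpha>, of h]
    by (auto simp: T_def perp_def k_def B_def)
  have perp_v: "cinner h v = 0" "cinner v h = 0" and perp_w: "cinner h w = 0" "cinner w h = 0"
    if "perp h" for h
    using sub that orthogonal_span_pair[of _ "szego \<alpha>" "mult_op (blaschke \<alpha>) (szego \<alpha>)" h]
    by (auto simp: perp_def w_def k_def B_def)

  \<comment> \<open>The model space is encoded as a double orthogonal complement;
    \<open>M_expand\<close> recovers the span.\<close>
  define M where "M f \<longleftrightarrow> (\<forall>h. perp h \<longrightarrow> cinner f h = 0)" for f
  have M_expand: "f = (s * cinner f k) *\<^sub>C k + (s * cinner f (B k)) *\<^sub>C B k" if "M f" for f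
    using mem_model_space[OF \<alpha>, of f] that by (simp add: M_def perp_def k_def B_def s_def)
  have M_k: "M k" and M_Bk: "M (B k)"
    by (auto simp: M_def perp_def cinner_commute[of k] cinner_commute[of "B k"])
  \<comment> \<open>Splitting \<open>g\<close> into its constant term and a shift leaves
    \<open>B (B one)\<close> as the only test vector: against \<open>shift (B (B g'))\<close> the
    shift part of \<open>T f\<close> pairs as \<open>f\<close> with \<open>B (B g')\<close>, and
    \<open>u\<close> pairs as \<open>w\<close>, and both vanish.\<close>
  have M_T: "M (T f)" if f: "M f" and \<theta>: "cinner (T f) (B (B one)) = 0" for f
    unfolding M_def
  proof safe
    fix h assume "perp h"
    then obtain g where h: "h = B (B g)" by (auto simp: perp_iff)
    define g' where "g' = adj shift g"
    have g: "g = hardy_eval g 0 *\<^sub>C one + shift g'"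
      unfolding g'_def one_def by (rule hardy_shift_decomp)
    have p: "perp (B (B g'))" by (auto simp: perp_iff)
    then have "cinner (T f) (shift (B (B g'))) = 0"
      using f by (simp add: T cinner_simps SS uS perp_w M_def)
    moreover have "h = hardy_eval g 0 *\<^sub>C B (B one) + shift (B (B g'))"
      unfolding h by (subst g) (simp add: Badd Bscale SB)
    ultimately show "cinner (T f) h = 0"
      using \<theta> by (simp add: cinner_simps)
  qed

  \<comment> \<open>Conditions (2) and (3) as orthogonality to the squared Blaschke factor\<close>
  have Tk_\<theta>: "cinner (T k) (B (B one)) = - cnj \<alpha> + a * U"
    by (simp add: T cinner_simps a U_def[symmetric] Sk BB c1 B_0 ck Bk_\<alpha>)
  have TBk_\<theta>: "cinner (T (B k)) (B (B one)) = 1 + b * U"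
    by (simp add: T cinner_simps Bkv U_def[symmetric] SB Sk Badd Bscale BB c1 B_0 ck Bk_\<alpha> one_ev)
  have conds: "cnj a + \<alpha> * cnj b = 0 \<and> b * U + 1 = 0 \<longleftrightarrow>
      cinner (T k) (B (B one)) = 0 \<and> cinner (T (B k)) (B (B one)) = 0"
  proof -
    have "cnj a + \<alpha> * cnj b = 0 \<longleftrightarrow> a + cnj \<alpha> * b = 0"
      by (metis complex_cnj_add complex_cnj_cnj complex_cnj_mult complex_cnj_zero_iff)
    \<comment> \<open>Condition (3) makes \<open>U\<close> nonzero, and multiplying the conjugate of
      (2) by \<open>U\<close> gives the orthogonality of \<open>T k\<close>.\<close>
    moreover have "- cnj \<alpha> + a * U = 0 \<longleftrightarrow> a + cnj \<alpha> * b = 0" if "b * U + 1 = 0"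
    proof -
      have bU: "b * U = -1" using that by (simp add: eq_neg_iff_add_eq_0)
      have "(a + cnj \<alpha> * b) * U = - cnj \<alpha> + a * U"
        using bU by (simp add: ring_distribs mult.assoc)
      moreover have "U \<noteq> 0" using bU by auto
      ultimately show ?thesis by (metis mult_eq_0_iff)
    qed
    ultimately show ?thesis unfolding Tk_\<theta> TBk_\<theta> by (auto simp: add.commute)
  qed

  \<comment> \<open>Coordinates on the model space\<close>
  define E where "E x = x $ 1 *\<^sub>C k + x $ 2 *\<^sub>C B k" for x :: "complex^2"
  have kBk: "cinner k (B k) = 0" "cinner (B k) k = 0" by (simp_all add: ck Bk_\<alpha>)
  \<comment> \<open>Up to the factor \<open>s\<close> the coordinate map is isometric, so the
    conjugate transpose represents the adjoint although the basis is not normalized.\<close>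
  have cE: "s * cinner (E x) (E y) = x $ 1 * cnj (y $ 1) + x $ 2 * cnj (y $ 2)" for x y
  proof -
    have "s * cinner (E x) (E y) = (s * cinner k k) * (x $ 1 * cnj (y $ 1) + x $ 2 * cnj (y $ 2))"
      by (simp add: E_def cinner_simps kBk BB algebra_simps)
    then show ?thesis by (simp add: sk)
  qed
  have s0: "s \<noteq> 0" using sk by auto
  have E_inj: "x = y" if "E x = E y" for x y
  proof -
    have "x $ 1 = s * cinner (E x) k" "x $ 2 = s * cinner (E x) (B k)" for x
      using sk by (simp_all add: E_def cinner_simps kBk BB mult.left_commute[of s])
    with that show ?thesis by (simp add: vec_eq_iff forall_2)
  qed
  have E_diff: "E (x - y) = E x - E y" for x y
    by (simp add: E_def hardy.scale_left_diff_distrib)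
  have M_imp_E: "\<exists>x. f = E x" if "M f" for f
    by (rule exI[of _ "vector [s * cinner f k, s * cinner f (B k)]"])
      (use M_expand[OF that] in \<open>simp add: E_def\<close>)
  have adjA: "cinner (E (conj_transpose A *v x)) (E y) = cinner (E x) (E (A *v y))" for x y
  proof -
    have "s * cinner (E (conj_transpose A *v x)) (E y) = s * cinner (E x) (E (A *v y))"
      unfolding cE by (simp add: matrix_vector_mult_def sum_2 map_matrix_def transpose_def algebra_simps)
    with s0 show ?thesis by simp
  qed

  \<comment> \<open>Commutation with the defect as normality of the matrix\<close>
  have core: "(\<forall>f. T (defect T f) = defect T (T f)) \<longleftrightarrow> normal_matrix A"
    if \<theta>: "cinner (T k) (B (B one)) = 0" "cinner (T (B k)) (B (B one)) = 0"
  proof -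
    have su: "s * cinner u k = hardy_eval u 0 + \<alpha> * R"
      by (simp add: ck u_\<alpha> R w_def[symmetric] s_def[symmetric])
        (simp add: s_eq algebra_simps)
    \<comment> \<open>This identifies \<open>R\<close> as the inner product of \<open>u\<close> with
      the Blaschke factor, which is how it enters the matrix entries.\<close>
    have uB: "cinner u (B one) = R"
    proof -
      have "cinner u (B one) = cinner u (shift k - \<alpha> *\<^sub>C k)" by (simp add: Sk)
      also have "\<dots> = hardy_eval w \<alpha> - cnj \<alpha> * hardy_eval u \<alpha>" by (simp add: cinner_simps uS ck)
      also have "\<dots> = R"
        by (simp add: u_\<alpha> R w_def[symmetric] s_def[symmetric]) (simp add: s_eq algebra_simps)
      finally show ?thesis .
    qed
    \<comment> \<open>For vectors orthogonal to \<open>B (B one)\<close>, \<open>sBk\<close>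
      replaces the coordinate along \<open>B k\<close> by the simpler pairing with
      \<open>B one\<close>.\<close>
    have sB: "s * cinner f (B k) = cinner f (B one)" if "cinner f (B (B one)) = 0" for f
    proof -
      have "s * cinner f (B k) = cinner f (s *\<^sub>C B k)" by (simp add: cinner_simps cnj_s)
      also have "\<dots> = cinner f (B one)" unfolding sBk using that by (simp add: cinner_simps)
      finally show ?thesis .
    qed
    have "s * cinner (T k) k = A $ 1 $ 1"
    proof -
      have "s * cinner (T k) k = \<alpha> * (s * hardy_eval k \<alpha>) + a * (s * cinner u k)"
        by (simp add: T cinner_simps a ck Se algebra_simps)
      then show ?thesis unfolding kk su by (simp add: A_def algebra_simps)
    qed
    moreover have "s * cinner (T k) (B k) = A $ 2 $ 1"
      unfolding sB[OF \<theta>(1)]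
      by (simp add: A_def T cinner_simps a uB Sk BB c1 one_ev ck Bk_\<alpha>)
    moreover have "s * cinner (T (B k)) k = A $ 1 $ 2"
    proof -
      have "s * cinner (T (B k)) k = b * (s * cinner u k)"
        by (simp add: T cinner_simps Bkv ck Se Bk_\<alpha>)
      then show ?thesis unfolding su by (simp add: A_def algebra_simps)
    qed
    moreover have "s * cinner (T (B k)) (B k) = A $ 2 $ 2"
    proof -
      have "cinner (shift (B k)) (B one) = cinner (shift k) one" by (simp only: SB BB)
      also have "\<dots> = 0" by (simp add: one_def cinner_szego hardy_eval_shift)
      finally show ?thesis
        unfolding sB[OF \<theta>(2)] by (simp add: A_def T cinner_simps Bkv uB)
    qed
    ultimately have Tk: "T k = A $ 1 $ 1 *\<^sub>C k + A $ 2 $ 1 *\<^sub>C B k"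
        and TBk: "T (B k) = A $ 1 $ 2 *\<^sub>C k + A $ 2 $ 2 *\<^sub>C B k"
      using M_expand[OF M_T[OF M_k \<theta>(1)]] M_expand[OF M_T[OF M_Bk \<theta>(2)]] by simp_all
    have TE: "T (E x) = E (A *v x)" for x
    proof -
      have "T (E x) = x $ 1 *\<^sub>C T k + x $ 2 *\<^sub>C T (B k)"
        by (simp only: E_def bounded_operator_add[OF bT] bounded_operator_scaleC[OF bT])
      also have "\<dots> = E (A *v x)"
        unfolding Tk TBk
        by (rule hardy_eqI) (simp add: E_def matrix_vector_mult_def sum_2 algebra_simps)
      finally show ?thesis .
    qed
    \<comment> \<open>The defect takes values in the span of \<open>v\<close> and \<open>w\<close>,
      inside the model space, so it is determined by its pairings with the vectors
      \<open>E z\<close>.\<close>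
    have DE: "defect T (E x) = E (x - conj_transpose A *v (A *v x))" for x
    proof -
      let ?d = "defect T (E x)"
      have "M ?d"
        unfolding M_def
        by (auto simp: T_def defect_shift_plus_rank_one cinner_simps perp_v perp_w w_def[symmetric])
      then obtain y where y: "?d = E y" using M_imp_E by blast
      let ?z = "y - (x - conj_transpose A *v (A *v x))"
      have "cinner (E y) (E z) = cinner (E (x - conj_transpose A *v (A *v x))) (E z)" for z
        unfolding y[symmetric] cinner_defect_left[OF bT]
        by (simp add: TE E_diff cinner_diff_left adjA)
      then have "cinner (E ?z) (E z) = 0" for z
        by (simp only: E_diff[of y] cinner_diff_left diff_self)
      then have "cinner (E ?z) (E ?z) = 0" .
      then show ?thesis unfolding y cinner_self_eq_0 E_diff[of y] by simp
    qed
    have comm: "T (defect T (E x)) = defect T (T (E x)) \<longleftrightarrow>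
        (A ** (conj_transpose A ** A)) *v x = ((conj_transpose A ** A) ** A) *v x" for x
    proof -
      have "T (defect T (E x)) = E (A *v x - (A ** (conj_transpose A ** A)) *v x)"
        by (simp add: DE TE matrix_vector_mult_diff_distrib matrix_vector_mul_assoc matrix_mul_assoc)
      moreover have "defect T (T (E x)) = E (A *v x - ((conj_transpose A ** A) ** A) *v x)"
        by (simp add: DE TE matrix_vector_mul_assoc matrix_mul_assoc)
      moreover have "E p = E q \<longleftrightarrow> p = q" for p q using E_inj by blast
      ultimately show ?thesis by (simp only:) simp
    qed
    \<comment> \<open>Commutation needs testing only on the model space: on its complement
      \<open>T\<close> is the shift, which preserves the complement, so both sides vanish
      there.\<close>
    have "(\<forall>f. T (defect T f) = defect T (T f)) \<longleftrightarrow> (\<forall>x. T (defect T (E x)) = defect T (T (E x)))"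
    proof safe
      fix f assume *: "\<forall>x. T (defect T (E x)) = defect T (T (E x))"
      define x where "x = (vector [s * cinner f k, s * cinner f (B k)] :: complex^2)"
      define h where "h = f - E x"
      have h: "perp h"
        using sk by (simp add: perp_def h_def x_def E_def cinner_simps kBk BB mult_ac)
      have "T h = shift h" by (simp add: T perp_v[OF h])
      then have Th: "defect T (T h) = 0" using perp_S[OF h] by (simp add: defect_0)
      have f: "f = E x + h" by (simp add: h_def)
      have Dadd: "defect T (f + g) = defect T f + defect T g" for f g
        by (rule cinner_ext)
          (simp add: cinner_defect_left[OF bT] cinner_add_left bounded_operator_add[OF bT])
      have "T (defect T f) = T (defect T (E x))"
        by (simp add: f Dadd defect_0[THEN iffD2, OF h])
      also have "\<dots> = defect T (T (E x))" using * by blast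
      also have "\<dots> = defect T (T f)"
        by (simp add: f Dadd Th bounded_operator_add[OF bT])
      finally show "T (defect T f) = defect T (T f)" .
    qed blast
    then show ?thesis
      unfolding comm normal_matrix_iff_quasinormal by (simp add: matrix_eq)
  qed

  text \<open>If \<open>T\<close> commutes with its self-adjoint defect, then \<open>T\<^sup>*\<close> preserves the kernel of the defect,
    so \<open>T\<close> preserves the orthogonal complement of that kernel.\<close>
  have necessary: "cinner (T f) (B (B one)) = 0"
    if comm: "\<forall>f. T (defect T f) = defect T (T f)" and f: "M f" for f
  proof -
    have "perp (B (B one))" by (auto simp: perp_iff)
    then have D0: "defect T (B (B one)) = 0" by (simp add: defect_0)
    have D: "cinner (defect T x) y = cinner x (defect T y)" for x y
      by (simp add: cinner_defect_left[OF bT] cinner_defect_right[OF bT])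
    have "cinner (defect T (adj T (B (B one)))) x = 0" for x
    proof -
      have "cinner (defect T (adj T (B (B one)))) x = cinner (B (B one)) (defect T (T x))"
        by (simp add: D cinner_adj_left[OF bT] comm)
      also have "\<dots> = 0" by (simp add: D[symmetric] D0)
      finally show ?thesis .
    qed
    then have "defect T (adj T (B (B one))) = 0" by (intro cinner_ext) simp
    then show ?thesis
      using f by (simp add: defect_0 M_def cinner_adj_right[OF bT, symmetric])
  qed
  \<comment> \<open>Either side forces \<open>T k\<close> and \<open>T (B k)\<close> to be
    orthogonal to \<open>B (B one)\<close>, by \<open>necessary\<close> or by \<open>conds\<close>;
    \<open>core\<close> then compares what remains.\<close>
  show ?thesis
    unfolding quasinormal_iff_defect[OF bT] U_eq A_def[symmetric]
    using core necessary M_k M_Bk conds by blast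
qed

theorem theorem4p3:
  fixes u v :: hardy and T :: "hardy \<Rightarrow> hardy"
  assumes "v \<noteq> adj shift u" and "hardy.independent {v, adj shift u}"
    and "T = (\<lambda>f. shift f + rank_one u v f)"
  shows "quasinormal_type_I T \<longleftrightarrow>
    (\<exists>\<alpha>\<in>ball 0 1.
       {v, adj shift u} \<subseteq> hardy.span {szego \<alpha>, mult_op (blaschke \<alpha>) (szego \<alpha>)} \<and>
       hardy_eval v \<alpha> + \<alpha> * hardy_eval (adj (mult_op (blaschke \<alpha>)) v) \<alpha> = 0 \<and>
       cnj (hardy_eval (adj (mult_op (blaschke \<alpha>)) v) \<alpha>)
         * cinner u (to_hardy (\<lambda>z. (blaschke \<alpha> z)\<^sup>2)) + 1 = 0 \<and>
       (let u0 = hardy_eval u 0;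
            R = (1 - (complex_of_real (cmod \<alpha>))\<^sup>2) * hardy_eval (adj shift u) \<alpha> - cnj \<alpha> * u0;
            a = cnj (hardy_eval v \<alpha>);
            b = cnj (hardy_eval (adj (mult_op (blaschke \<alpha>)) v) \<alpha>)
        in normal_matrix (vector
             [vector [a * u0 + \<alpha> * (1 + a * R), b * u0 + \<alpha> * b * R],
              vector [1 + a * R,                b * R]] :: complex^2^2)))"
    (is "_ \<longleftrightarrow> (\<exists>\<alpha>\<in>ball 0 1. ?sub \<alpha> \<and> ?conds \<alpha>)")
proof -
  \<comment> \<open>For fixed \<alpha> the kernel identity is condition (1), and under it
    quasinormality amounts to the other three. Quasinormality does not depend on \<alpha>, so it can
    be moved under the quantifier.\<close>
  have *: "quasinormal T \<and> {f. f - adj T (T f) = 0} = range (mult_op (\<lambda>z. (blaschke \<alpha> z)\<^sup>2))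
      \<longleftrightarrow> ?sub \<alpha> \<and> ?conds \<alpha>" if \<alpha>: "\<alpha> \<in> ball 0 1" for \<alpha>
  proof -
    have "{f. f - adj T (T f) = 0} = range (mult_op (\<lambda>z. (blaschke \<alpha> z)\<^sup>2)) \<longleftrightarrow> ?sub \<alpha>"
      using defect_kernel_iff[OF \<alpha> assms(1,2)] by (simp only: defect_def assms(3))
    moreover have "quasinormal T \<longleftrightarrow> ?conds \<alpha>" if "?sub \<alpha>"
      unfolding assms(3) Let_def
        quasinormal_shift_plus_rank_one_iff[OF \<alpha> assms(1,2) that refl refl refl] complex_cnj_cnj ..
    ultimately show ?thesis by argo
  qed
  have "quasinormal_type_I T \<longleftrightarrow> (\<exists>\<alpha>\<in>ball 0 1. quasinormal T \<and>
      {f. f - adj T (T f) = 0} = range (mult_op (\<lambda>z. (blaschke \<alpha> z)\<^sup>2)))"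
    unfolding quasinormal_type_I_def by (simp only: bex_simps)
  also have "\<dots> \<longleftrightarrow> (\<exists>\<alpha>\<in>ball 0 1. ?sub \<alpha> \<and> ?conds \<alpha>)"
    by (rule bex_cong[OF refl *])
  finally show ?thesis .
qed

end
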